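(* There exist absolute constants $K>0$ and $C>0$ such that the following holds. Let $n\ge1$ and $p\in(0,1)$ be such that $pn$ is an integer and $p(1-p)n\ge 3\log n$. Let $f$ be a real harmonic multilinear polynomial in $x_1,\dots,x_n$ of degree $d$ satisfying $d\le K\sqrt{p(1-p)n}$ and such that the variance of $f$ with respect to $\nu_{pn}$ equals $1$. Then the Lévy distance between the distribution of $f$ under $\nu_{pn}$ and the distribution of $f$ under $\mu_p$ is at most $$\epsilon= C\left(\frac{d}{\sqrt{p(1-p)n}}\right)^{1/4};$$ that is, for all $y\in\mathbb R$, $$\Pr_{\nu_{pn}}[f\le y-\epsilon]-\epsilon\le\Pr_{\mu_p}[f\le y]\le\Pr_{\nu_{pn}}[f\le y+\epsilon]+\epsilon.$$
   Context: A polynomial in $x_1,\dots,x_n$ is multilinear if all its monomials are squarefree, and harmonic if $\sum_{i=1}^n \frac{\partial f}{\partial x_i}=0$. For an integer $0\le k\le n$, $\nu_k$ is the uniform probability measure on the slice $\{x\in\{0,1\}^n:\sum_i x_i=k\}$. For $p\in(0,1)$, $\mu_p$ is the product measure on $\{0,1\}^n$ with $\mu_p(x)=p^{\sum_i x_i}(1-p)^{\sum_i(1-x_i)}$. *)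

theory Defs
  imports "HOL-Probability.Probability" "HOL-Library.Poly_Mapping"
begin

subsection \<open>Real polynomials in finitely many of the variables $x_1, x_2, \dots$\<close>

text \<open>A monomial is a finitely supported exponent vector, and a polynomial is a finitely
  supported map from monomials to coefficients. The key \<open>i\<close> of a monomial stands for the
  variable $x_i$.\<close>

type_synonym monomial = "nat \<Rightarrow>\<^sub>0 nat"
type_synonym real_mpoly = "monomial \<Rightarrow>\<^sub>0 real"

definition poly_in_vars :: "nat \<Rightarrow> real_mpoly \<Rightarrow> bool" where
  "poly_in_vars n f \<longleftrightarrow> (\<forall>m \<in> Poly_Mapping.keys f. Poly_Mapping.keys m \<subseteq> {1..n})"

definition poly_eval :: "real_mpoly \<Rightarrow> (nat \<Rightarrow> real) \<Rightarrow> real" where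
  "poly_eval f x =
     (\<Sum>m \<in> Poly_Mapping.keys f.
        Poly_Mapping.lookup f m * (\<Prod>i \<in> Poly_Mapping.keys m. x i ^ Poly_Mapping.lookup m i))"

definition monomial_degree :: "monomial \<Rightarrow> nat" where
  "monomial_degree m = (\<Sum>i \<in> Poly_Mapping.keys m. Poly_Mapping.lookup m i)"

text \<open>The zero polynomial gets degree 0.\<close>

definition poly_degree :: "real_mpoly \<Rightarrow> nat" where
  "poly_degree f = Max (insert 0 (monomial_degree ` Poly_Mapping.keys f))"

definition multilinear_poly :: "real_mpoly \<Rightarrow> bool" where
  "multilinear_poly f \<longleftrightarrow>
     (\<forall>m \<in> Poly_Mapping.keys f. \<forall>i. Poly_Mapping.lookup m i \<le> 1)"

text \<open>Formal partial derivative. If $x_i$ does not occur in \<open>m\<close>, the truncated subtraction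
  of exponents is harmless, as the coefficient is multiplied by 0.\<close>

definition partial_deriv :: "nat \<Rightarrow> real_mpoly \<Rightarrow> real_mpoly" where
  "partial_deriv i f =
     (\<Sum>m \<in> Poly_Mapping.keys f.
        Poly_Mapping.single (m - Poly_Mapping.single i 1)
          (real (Poly_Mapping.lookup m i) * Poly_Mapping.lookup f m))"

definition harmonic_poly :: "nat \<Rightarrow> real_mpoly \<Rightarrow> bool" where
  "harmonic_poly n f \<longleftrightarrow> (\<Sum>i = 1..n. partial_deriv i f) = 0"


subsection \<open>The measures on the slice and on the cube\<close>

text \<open>A point of the cube is a function on the naturals that takes values in $\{0,1\}$ on
  the coordinates $1,\dots,n$ and the dummy value 0 elsewhere.\<close>

definition cube :: "nat \<Rightarrow> (nat \<Rightarrow> nat) set" where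
  "cube n = PiE_dflt {1..n} 0 (\<lambda>_. {0, 1})"

definition slice :: "nat \<Rightarrow> nat \<Rightarrow> (nat \<Rightarrow> nat) set" where
  "slice n k = {x \<in> cube n. (\<Sum>i = 1..n. x i) = k}"

text \<open>Only meaningful for $k \le n$, where the slice is nonempty.\<close>

definition slice_measure :: "nat \<Rightarrow> nat \<Rightarrow> (nat \<Rightarrow> nat) pmf" where
  "slice_measure n k = pmf_of_set (slice n k)"

definition product_measure :: "nat \<Rightarrow> real \<Rightarrow> (nat \<Rightarrow> nat) pmf" where
  "product_measure n p = Pi_pmf {1..n} 0 (\<lambda>_. map_pmf of_bool (bernoulli_pmf p))"

definition cube_eval :: "real_mpoly \<Rightarrow> (nat \<Rightarrow> nat) \<Rightarrow> real" where
  "cube_eval f x = poly_eval f (\<lambda>i. real (x i))"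

lemma finite_slice: "finite (slice n k)"
  unfolding slice_def cube_def by (intro finite_subset[OF _ finite_PiE_dflt]) auto

lemma slice_nonempty:
  assumes "k \<le> n"
  shows "slice n k \<noteq> {}"
proof -
  let ?x = "\<lambda>i::nat. if i \<in> {1..k} then 1 else 0 :: nat"
  have "(\<Sum>i = 1..n. ?x i) = (\<Sum>i = 1..k. 1)"
    using assms by (intro sum.mono_neutral_cong_right) auto
  hence "(\<Sum>i = 1..n. ?x i) = k"
    by simp
  moreover have "?x \<in> cube n"
    using assms by (auto simp: cube_def PiE_dflt_def)
  ultimately have "?x \<in> slice n k"
    unfolding slice_def by blast
  thus ?thesis by blast
qed

lemma pmf_product_measure:
  assumes "0 < p" "p < 1" "x \<in> cube n"
  shows "pmf (product_measure n p) x =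
           p ^ (\<Sum>i = 1..n. x i) * (1 - p) ^ (\<Sum>i = 1..n. 1 - x i)"
proof -
  have pmf1: "pmf (map_pmf (of_bool :: bool \<Rightarrow> nat) (bernoulli_pmf p)) a = p ^ a * (1 - p) ^ (1 - a)"
    if "a \<in> {0, 1}" for a :: nat
  proof -
    have inj: "inj (of_bool :: bool \<Rightarrow> nat)"
      by (auto simp: inj_def)
    have "pmf (map_pmf (of_bool :: bool \<Rightarrow> nat) (bernoulli_pmf p)) (of_bool b) =
            pmf (bernoulli_pmf p) b" for b
      by (rule pmf_map_inj'[OF inj])
    from this[of True] this[of False] show ?thesis
      using that assms by auto
  qed
  have dom: "x i \<in> {0, 1}" if "i \<in> {1..n}" for i
    using assms(3) that by (auto simp: cube_def PiE_dflt_def)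
  have "pmf (product_measure n p) x =
          (\<Prod>i = 1..n. pmf (map_pmf (of_bool :: bool \<Rightarrow> nat) (bernoulli_pmf p)) (x i))"
    unfolding product_measure_def
    by (rule pmf_Pi') (use assms(3) in \<open>auto simp: cube_def PiE_dflt_def\<close>)
  also have "\<dots> = (\<Prod>i = 1..n. p ^ x i * (1 - p) ^ (1 - x i))"
    by (intro prod.cong refl pmf1 dom)
  also have "\<dots> = p ^ (\<Sum>i = 1..n. x i) * (1 - p) ^ (\<Sum>i = 1..n. 1 - x i)"
    by (simp add: prod.distrib power_sum)
  finally show ?thesis .
qed


subsection \<open>Levy distance of two probability distributions on the reals\<close>

definition levy_distance :: "real measure \<Rightarrow> real measure \<Rightarrow> real" where
  "levy_distance M N =
     Inf {\<epsilon>. \<epsilon> > 0 \<and> (\<forall>y. cdf M (y - \<epsilon>) - \<epsilon> \<le> cdf N y \<and> cdf N y \<le> cdf M (y + \<epsilon>) + \<epsilon>)}"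

end

theory Submission
  imports Defs
begin

text \<open>The polynomial is split into its homogeneous parts $f_i$, each of them harmonic. On the layers of the
  Boolean lattice a harmonic $f_i$ is an eigenfunction: adding a random new element to a set of size $m$
  multiplies the conditional mean of $f_i$ by $1 - i/(n-m)$, and removing a random element multiplies
  it by $1 - i/m$ (\<open>layer_eigen_homogeneous\<close>). Comparing the two operations shows that parts of
  different degrees with sum at most $n$ are orthogonal on every layer (\<open>sum_layer_orthogonal\<close>), so the variance on a
  layer is the sum of the second moments of the $f_i$ with $i \ge 1$.

  Let $A \subseteq B$ be a uniformly random nested pair of sets of sizes $k$ and $l$. The correlation of
  $f_i(A)$ and $f_i(B)$ is a product of eigenvalues times the second moment on either layer
  (\<open>pair_mean_mult_upper\<close>, \<open>pair_mean_mult_lower\<close>). Hence the mean of $(f(A) - f(B))^2$ is an explicit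
  sum over $i$. For $f$ of variance 1 on layer $pn$ it is at most a constant times
  $d\,|k-l| / (p(1-p)n)$ if $k$ or $l$ equals $pn$ and $|k-l|$ is not too large
  (\<open>pair_mean_square_diff_le\<close>). By Markov's inequality the distribution functions of $f$
  on the two layers are then close (\<open>layers_close\<close>).

  A point of the cube under the product measure has binomial weight with mean $pn$ and variance
  $\sigma^2 = p(1-p)n$, and is uniform given its weight. With $\delta = d/\sigma$, the weights within
  $T = \sigma \delta^{-1/8}$ of $pn$ contribute an error of order $d T / (\sigma^2 \epsilon^2)$, which is of order
  $\delta^{3/8}$ for $\epsilon$ of order $\delta^{1/4}$, and the others have probability at most $\sigma^2/T^2 = \delta^{1/4}$
  (\<open>binomial_mixture_close\<close>). When the claimed bound is at least 1 there is nothing to prove.\<close>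

section \<open>Layers of the Boolean lattice\<close>

text \<open>Points of the slice are handled as their supports, so that the slice of weight $k$ becomes the
  family of $k$-element subsets.\<close>

definition layer :: "'a set \<Rightarrow> nat \<Rightarrow> 'a set set" where
  "layer V k = {A. A \<subseteq> V \<and> card A = k}"

lemma finite_layer [simp]: "finite V \<Longrightarrow> finite (layer V k)"
  unfolding layer_def by (rule finite_subset[of _ "Pow V"]) auto

lemma card_layer: "finite V \<Longrightarrow> card (layer V k) = card V choose k"
  unfolding layer_def by (rule n_subsets)

lemma layer_subset_eq:
  assumes "finite V" "A \<in> layer V k" "B \<in> layer V k" "A \<subseteq> B"
  shows "A = B"
  using assms by (intro card_subset_eq) (auto simp: layer_def intro: finite_subset)

lemma sum_if_scale:
  fixes F :: "'b \<Rightarrow> real"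
  assumes "finite L"
  shows "(\<Sum>B\<in>L. if P B then r * F B else 0) = r * (\<Sum>B | B \<in> L \<and> P B. F B)"
  using assms by (simp add: sum_distrib_left sum.inter_filter if_distrib[of "(*) r"] cong: if_cong)

lemma real_card_Diff: "finite B \<Longrightarrow> A \<subseteq> B \<Longrightarrow> real (card (B - A)) = real (card B) - real (card A)"
  by (simp add: card_Diff_subset finite_subset of_nat_diff card_mono)

text \<open>Both sides sum over the edges of the Hasse diagram between two consecutive layers. Evaluating such a sum
  from either end is what drives the arguments below.\<close>

lemma sum_layer_step:
  fixes g :: "'a set \<Rightarrow> 'a set \<Rightarrow> real"
  assumes "finite V"
  shows "(\<Sum>A\<in>layer V k. \<Sum>v\<in>V - A. g A (insert v A)) =
         (\<Sum>B\<in>layer V (Suc k). \<Sum>v\<in>B. g (B - {v}) B)"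
proof -
  have fin: "finite A" if "A \<in> layer V l" for A l
    using that assms by (auto simp: layer_def intro: finite_subset)
  have "(\<Sum>A\<in>layer V k. \<Sum>v\<in>V - A. g A (insert v A)) =
          (\<Sum>(A, v)\<in>Sigma (layer V k) (\<lambda>A. V - A). g A (insert v A))"
    using assms by (subst sum.Sigma) auto
  also have "\<dots> = (\<Sum>(B, v)\<in>Sigma (layer V (Suc k)) (\<lambda>B. B). g (B - {v}) B)"
  proof (rule sum.reindex_bij_witness[of _ "\<lambda>(B, v). (B - {v}, v)" "\<lambda>(A, v). (insert v A, v)"],
      goal_cases)
    case (1 a)
    then show ?case by (cases a) auto
  next
    case (2 a)
    then obtain A v where a: "a = (A, v)" "A \<in> layer V k" "v \<in> V" "v \<notin> A" by blast
    then show ?case using fin[OF a(2)] by (simp add: layer_def)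
  next
    case (3 b)
    then show ?case by (cases b) (simp add: insert_absorb)
  next
    case (4 b)
    then obtain B v where b: "b = (B, v)" "B \<in> layer V (Suc k)" "v \<in> B" by blast
    then show ?case using fin[OF b(2)] by (auto simp: layer_def)
  next
    case (5 a)
    then show ?case by (cases a) auto
  qed
  also have "\<dots> = (\<Sum>B\<in>layer V (Suc k). \<Sum>v\<in>B. g (B - {v}) B)"
    using assms fin by (subst sum.Sigma) auto
  finally show ?thesis .
qed

section \<open>Harmonic homogeneous functions\<close>

text \<open>The two facts about a harmonic homogeneous polynomial of degree $i$ that the proof uses: it is an
  eigenfunction of one random step up and of one random step down. Multiplying out the transition
  probabilities gives the sums below.\<close>

definition layer_eigen :: "'a set \<Rightarrow> nat \<Rightarrow> ('a set \<Rightarrow> real) \<Rightarrow> bool" where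
  "layer_eigen V i F \<longleftrightarrow> (\<forall>A\<subseteq>V.
     (\<Sum>v\<in>V - A. F (insert v A)) = (real (card V) - real (card A) - real i) * F A \<and>
     (\<Sum>v\<in>A. F (A - {v})) = (real (card A) - real i) * F A)"

lemma layer_eigen_const: "finite V \<Longrightarrow> layer_eigen V 0 (\<lambda>_. c)"
  unfolding layer_eigen_def
  by (simp add: real_card_Diff)

lemma layer_eigen_up:
  "layer_eigen V i F \<Longrightarrow> A \<in> layer V k \<Longrightarrow>
     (\<Sum>v\<in>V - A. F (insert v A)) = (real (card V) - real k - real i) * F A"
  by (auto simp: layer_eigen_def layer_def)

lemma layer_eigen_down:
  "layer_eigen V i F \<Longrightarrow> A \<in> layer V k \<Longrightarrow>
     (\<Sum>v\<in>A. F (A - {v})) = (real k - real i) * F A"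
  by (auto simp: layer_eigen_def layer_def)

text \<open>For $f = \sum_S c_S x_S$ homogeneous of degree $i$, the step from \<open>A\<close> to \<open>insert v A\<close> changes the value by
  the partial derivative in direction $v$. Over all $v \notin A$ these derivatives add up to minus
  their sum over $v \in A$, by harmonicity, and the latter is $i f$ by Euler's identity. The second
  identity just counts the sets $S \subseteq A$ avoiding $v$.\<close>

lemma layer_eigen_homogeneous:
  fixes c :: "'a set \<Rightarrow> real"
  assumes V: "finite V" and harm: "\<And>S. S \<subseteq> V \<Longrightarrow> (\<Sum>v\<in>V - S. c (insert v S)) = 0"
  shows "layer_eigen V i (\<lambda>A. \<Sum>S\<in>layer A i. c S)"
proof -
  define F where "F = (\<lambda>A. \<Sum>S\<in>layer A i. c S)"
  have up: "(\<Sum>v\<in>V - A. F (insert v A)) = (real (card V) - real (card A) - real i) * F A"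
    if A: "A \<subseteq> V" for A
  proof -
    have fA: "finite A" using A V by (rule finite_subset)
    have cVA: "real (card (V - A)) = real (card V) - real (card A)"
      by (rule real_card_Diff[OF V A])
    show ?thesis
    proof (cases i)
      case 0
      then have "layer B i = {{}}" if "finite B" for B :: "'a set"
        using that by (auto simp: layer_def finite_subset)
      then have "F B = c {}" if "finite B" for B
        using that by (simp add: F_def)
      then show ?thesis using fA cVA 0 by simp
    next
      case (Suc j)
      have split: "F (insert v A) = F A + (\<Sum>S\<in>layer A j. c (insert v S))" if v: "v \<in> V - A" for v
      proof -
        have eq: "layer (insert v A) i = layer A i \<union> insert v ` layer A j"
        proof (intro equalityI subsetI)
          fix S assume S: "S \<in> layer (insert v A) i"
          then have fS: "finite S" using fA by (auto simp: layer_def intro: finite_subset)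
          show "S \<in> layer A i \<union> insert v ` layer A j"
          proof (cases "v \<in> S")
            case True
            then have "S = insert v (S - {v})" "S - {v} \<in> layer A j"
              using S Suc fS by (auto simp: layer_def)
            then show ?thesis by blast
          qed (use S in \<open>auto simp: layer_def\<close>)
        next
          fix S assume "S \<in> layer A i \<union> insert v ` layer A j"
          then show "S \<in> layer (insert v A) i"
          proof
            assume "S \<in> insert v ` layer A j"
            then obtain S' where S': "S = insert v S'" "S' \<subseteq> A" "card S' = j"
              by (auto simp: layer_def)
            then have "finite S'" "v \<notin> S'" using fA v by (auto intro: finite_subset)
            then show ?thesis using S' Suc by (auto simp: layer_def)
          qed (auto simp: layer_def)
        qed
        have inj: "inj_on (insert v) (layer A j)"
          using v by (auto simp: inj_on_def layer_def)
        have disj: "layer A i \<inter> insert v ` layer A j = {}"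
          using v by (auto simp: layer_def)
        show ?thesis
          unfolding F_def eq using fA disj
          by (simp add: sum.union_disjoint sum.reindex[OF inj])
      qed
      have "(\<Sum>v\<in>V - A. \<Sum>S\<in>layer A j. c (insert v S)) = (\<Sum>S\<in>layer A j. \<Sum>v\<in>V - A. c (insert v S))"
        by (rule sum.swap)
      also have "\<dots> = (\<Sum>S\<in>layer A j. - (\<Sum>v\<in>A - S. c (insert v S)))"
      proof (intro sum.cong refl)
        fix S assume "S \<in> layer A j"
        then have S: "S \<subseteq> A" by (auto simp: layer_def)
        have "(\<Sum>v\<in>V - S. c (insert v S)) = (\<Sum>v\<in>(V - A) \<union> (A - S). c (insert v S))"
          using S A by (intro sum.cong) auto
        also have "\<dots> = (\<Sum>v\<in>V - A. c (insert v S)) + (\<Sum>v\<in>A - S. c (insert v S))"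
          using V fA by (intro sum.union_disjoint) auto
        finally show "(\<Sum>v\<in>V - A. c (insert v S)) = - (\<Sum>v\<in>A - S. c (insert v S))"
          using harm[of S] S A by simp
      qed
      also have "\<dots> = - (\<Sum>S\<in>layer A i. \<Sum>v\<in>S. c S)"
        using sum_layer_step[OF fA, of "\<lambda>_ B. c B" j] Suc by (simp add: sum_negf)
      also have "\<dots> = - real i * F A"
        by (simp add: F_def sum_distrib_left layer_def sum_negf)
      finally have "(\<Sum>v\<in>V - A. \<Sum>S\<in>layer A j. c (insert v S)) = - real i * F A" .
      moreover have "(\<Sum>v\<in>V - A. F (insert v A)) =
          real (card (V - A)) * F A + (\<Sum>v\<in>V - A. \<Sum>S\<in>layer A j. c (insert v S))"
        by (simp add: split sum.distrib)
      ultimately show ?thesis unfolding cVA by (simp add: left_diff_distrib)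
    qed
  qed
  have down: "(\<Sum>v\<in>A. F (A - {v})) = (real (card A) - real i) * F A" if A: "A \<subseteq> V" for A
  proof -
    have fA: "finite A" using A V by (rule finite_subset)
    have "(\<Sum>v\<in>A. F (A - {v})) = (\<Sum>v\<in>A. \<Sum>S | S \<in> layer A i \<and> v \<notin> S. c S)"
      unfolding F_def by (intro sum.cong) (auto simp: layer_def)
    also have "\<dots> = (\<Sum>S\<in>layer A i. \<Sum>v | v \<in> A \<and> v \<notin> S. c S)"
      using fA by (intro sum.swap_restrict) auto
    also have "\<dots> = (\<Sum>S\<in>layer A i. (real (card A) - real i) * c S)"
    proof (intro sum.cong refl)
      fix S assume S: "S \<in> layer A i"
      then have "real (card (A - S)) = real (card A) - real i"
        using real_card_Diff[OF fA, of S] by (simp add: layer_def)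
      moreover have "{v. v \<in> A \<and> v \<notin> S} = A - S" by auto
      ultimately show "(\<Sum>v | v \<in> A \<and> v \<notin> S. c S) = (real (card A) - real i) * c S" by simp
    qed
    finally show ?thesis by (simp add: F_def sum_distrib_left)
  qed
  show ?thesis unfolding layer_eigen_def F_def[symmetric] using up down by blast
qed

text \<open>The sum of $F(A) G(B)$ over the edges $A \subset B$ between layers $k$ and $k+1$ can be evaluated from
  either end, and so can the sum with $F$ and $G$ exchanged. This gives two linear equations for the
  two inner products, on layers $k$ and $k+1$, whose determinant is $(i-j)(n+1-i-j)$ up to sign.\<close>

lemma sum_layer_orthogonal:
  assumes V: "finite V" and F: "layer_eigen V i F" and G: "layer_eigen V j G"
    and ij: "i \<noteq> j" "i + j \<le> card V" and k: "k \<le> card V"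
  shows "(\<Sum>A\<in>layer V k. F A * G A) = 0"
proof -
  let ?n = "real (card V)"
  define q where "q = (\<lambda>k. \<Sum>A\<in>layer V k. F A * G A)"
  have step: "(?n - real k - real j) * (\<Sum>A\<in>layer V k. F A * G A) =
                (real (Suc k) - real i) * (\<Sum>A\<in>layer V (Suc k). F A * G A)"
    if "layer_eigen V i F" "layer_eigen V j G" for F G i j
  proof -
    have "(?n - real k - real j) * (\<Sum>A\<in>layer V k. F A * G A) =
            (\<Sum>A\<in>layer V k. \<Sum>v\<in>V - A. F A * G (insert v A))"
      by (simp add: sum_distrib_left[symmetric] layer_eigen_up[OF that(2)])
         (simp add: sum_distrib_left mult_ac)
    also have "\<dots> = (\<Sum>B\<in>layer V (Suc k). \<Sum>v\<in>B. F (B - {v}) * G B)"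
      by (rule sum_layer_step[OF V])
    also have "\<dots> = (real (Suc k) - real i) * (\<Sum>A\<in>layer V (Suc k). F A * G A)"
      by (simp add: sum_distrib_right[symmetric] layer_eigen_down[OF that(1)])
         (simp add: sum_distrib_left mult_ac)
    finally show ?thesis .
  qed
  have e1: "(?n - real k - real j) * q k = (real (Suc k) - real i) * q (Suc k)"
    unfolding q_def by (rule step[OF F G])
  have e2: "(?n - real k - real i) * q k = (real (Suc k) - real j) * q (Suc k)"
    using step[OF G F] unfolding q_def by (simp add: mult.commute)
  have "(real (Suc k) - real j) * ((?n - real k - real j) * q k) =
        (real (Suc k) - real i) * ((?n - real k - real i) * q k)"
    unfolding e1 e2 by simp
  then have "(real i - real j) * (?n + 1 - real i - real j) * q k = 0"
    by (simp add: algebra_simps)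
  moreover have "?n + 1 - real i - real j > 0" using ij(2) by linarith
  ultimately show ?thesis using ij(1) by (simp add: q_def)
qed

text \<open>The eigenvalues of averaging from layer $k$ up to layer $l$, and from layer $l$ down to layer $k$.\<close>

definition up_ratio :: "nat \<Rightarrow> nat \<Rightarrow> nat \<Rightarrow> nat \<Rightarrow> real" where
  "up_ratio n i k l = (\<Prod>t = k..<l. 1 - real i / (real n - real t))"

definition down_ratio :: "nat \<Rightarrow> nat \<Rightarrow> nat \<Rightarrow> real" where
  "down_ratio i k l = (\<Prod>t = k..<l. 1 - real i / (real t + 1))"

text \<open>Induction on $l$: counting the edges between layers $l$ and $l+1$ that lie above \<open>A\<close> relates the two
  consecutive sums by the eigenvalue equation.\<close>

lemma sum_supersets:
  assumes V: "finite V" and F: "layer_eigen V i F" and A: "A \<in> layer V k"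
    and "k \<le> l" "l \<le> card V"
  shows "(\<Sum>B | B \<in> layer V l \<and> A \<subseteq> B. F B) =
           real ((card V - k) choose (l - k)) * up_ratio (card V) i k l * F A"
  using assms(4,5)
proof (induction l rule: dec_induct)
  case base
  have "{B. B \<in> layer V k \<and> A \<subseteq> B} = {A}"
    using layer_subset_eq[OF V A] A by blast
  then show ?case by (simp add: up_ratio_def)
next
  case (step l)
  let ?n = "card V"
  let ?G = "\<lambda>l. \<Sum>B | B \<in> layer V l \<and> A \<subseteq> B. F B"
  have "(\<Sum>B\<in>layer V l. \<Sum>v\<in>V - B. if A \<subseteq> B then F (insert v B) else 0) =
        (\<Sum>B\<in>layer V (Suc l). \<Sum>v\<in>B. if A \<subseteq> B - {v} then F B else 0)"
    by (rule sum_layer_step[OF V, of "\<lambda>B B'. if A \<subseteq> B then F B' else 0"])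
  moreover have "(\<Sum>B\<in>layer V l. \<Sum>v\<in>V - B. if A \<subseteq> B then F (insert v B) else 0) =
      (real ?n - real l - real i) * ?G l"
  proof -
    have "(\<Sum>B\<in>layer V l. \<Sum>v\<in>V - B. if A \<subseteq> B then F (insert v B) else 0) =
       (\<Sum>B\<in>layer V l. if A \<subseteq> B then (real ?n - real l - real i) * F B else 0)"
      by (intro sum.cong) (auto simp: layer_eigen_up[OF F])
    also have "\<dots> = (real ?n - real l - real i) * ?G l"
      using V by (simp only: sum_if_scale finite_layer)
    finally show ?thesis .
  qed
  moreover have "(\<Sum>B\<in>layer V (Suc l). \<Sum>v\<in>B. if A \<subseteq> B - {v} then F B else 0) =
      (real (Suc l) - real k) * ?G (Suc l)"
  proof -
    have "(\<Sum>B\<in>layer V (Suc l). \<Sum>v\<in>B. if A \<subseteq> B - {v} then F B else 0) =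
       (\<Sum>B\<in>layer V (Suc l). if A \<subseteq> B then (real (Suc l) - real k) * F B else 0)"
    proof (intro sum.cong refl)
      fix B assume B: "B \<in> layer V (Suc l)"
      then have fB: "finite B" using V by (auto simp: layer_def intro: finite_subset)
      show "(\<Sum>v\<in>B. if A \<subseteq> B - {v} then F B else 0) =
              (if A \<subseteq> B then (real (Suc l) - real k) * F B else 0)"
      proof (cases "A \<subseteq> B")
        case True
        have "(\<Sum>v\<in>B. if A \<subseteq> B - {v} then F B else 0) = (\<Sum>v\<in>B - A. F B)"
          using True fB by (intro sum.mono_neutral_cong_right) auto
        then show ?thesis
          using True B A real_card_Diff[OF fB True] by (simp add: layer_def)
      next
        case False
        then show ?thesis by (subst sum.neutral) auto
      qed
    qed
    also have "\<dots> = (real (Suc l) - real k) * ?G (Suc l)"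
      using V by (simp only: sum_if_scale finite_layer)
    finally show ?thesis .
  qed
  ultimately have G: "(real (Suc l) - real k) * ?G (Suc l) = (real ?n - real l - real i) * ?G l"
    by simp
  have "Suc (l - k) * ((?n - k) choose Suc (l - k)) = (?n - k - (l - k)) * ((?n - k) choose (l - k))"
    using binomial_absorption[of "l - k" "?n - k"] binomial_absorb_comp[of "?n - k" "l - k"] by simp
  then have "real (Suc (l - k) * ((?n - k) choose Suc (l - k))) =
               real ((?n - k - (l - k)) * ((?n - k) choose (l - k)))" by simp
  moreover have "real (Suc (l - k)) = real (Suc l) - real k" using step by simp
  moreover have "real (?n - k - (l - k)) = real ?n - real l" using step by (simp add: of_nat_diff)
  moreover have "Suc (l - k) = Suc l - k" using step by simp
  ultimately have C: "(real (Suc l) - real k) * real ((?n - k) choose (Suc l - k)) =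
               (real ?n - real l) * real ((?n - k) choose (l - k))"
    by (metis of_nat_mult)
  have U: "(real ?n - real l) * up_ratio ?n i k (Suc l) =
             (real ?n - real l - real i) * up_ratio ?n i k l"
    using step by (simp add: up_ratio_def field_simps)
  have pos: "real (Suc l) - real k > 0" using step by simp
  have IH: "?G l = real ((?n - k) choose (l - k)) * up_ratio ?n i k l * F A"
    using step by simp
  have "(real (Suc l) - real k) * (real ((?n - k) choose (Suc l - k)) * up_ratio ?n i k (Suc l) * F A)
      = (real ?n - real l) * real ((?n - k) choose (l - k)) * up_ratio ?n i k (Suc l) * F A"
    using C by simp
  also have "\<dots> = ((real ?n - real l) * up_ratio ?n i k (Suc l)) * real ((?n - k) choose (l - k)) * F A"
    by simp
  also have "\<dots> = (real ?n - real l - real i) * ?G l"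
    unfolding U IH by simp
  also have "\<dots> = (real (Suc l) - real k) * ?G (Suc l)" using G by simp
  finally show ?case using pos by (metis mult_left_cancel less_numeral_extra(3))
qed

text \<open>The mirror image of the previous argument, with the edges that lie below \<open>B\<close>.\<close>

lemma sum_subsets:
  assumes V: "finite V" and F: "layer_eigen V i F" and B: "B \<in> layer V l" and "k \<le> l"
  shows "(\<Sum>A | A \<in> layer V k \<and> A \<subseteq> B. F A) = real (l choose k) * down_ratio i k l * F B"
  using assms(4)
proof (induction k rule: inc_induct)
  case base
  have "{A. A \<in> layer V l \<and> A \<subseteq> B} = {B}"
    using layer_subset_eq[OF V _ B] B by blast
  then show ?case by (simp add: down_ratio_def)
next
  case (step k)
  let ?H = "\<lambda>k. \<Sum>A | A \<in> layer V k \<and> A \<subseteq> B. F A"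
  have fB: "finite B" "B \<subseteq> V" "card B = l"
    using B V by (auto simp: layer_def intro: finite_subset)
  have "(\<Sum>A\<in>layer V k. \<Sum>v\<in>V - A. if insert v A \<subseteq> B then F A else 0) =
        (\<Sum>A\<in>layer V (Suc k). \<Sum>v\<in>A. if A \<subseteq> B then F (A - {v}) else 0)"
    by (rule sum_layer_step[OF V, of "\<lambda>A A'. if A' \<subseteq> B then F A else 0"])
  moreover have "(\<Sum>A\<in>layer V (Suc k). \<Sum>v\<in>A. if A \<subseteq> B then F (A - {v}) else 0) =
      (real (Suc k) - real i) * ?H (Suc k)"
  proof -
    have "(\<Sum>A\<in>layer V (Suc k). \<Sum>v\<in>A. if A \<subseteq> B then F (A - {v}) else 0) =
       (\<Sum>A\<in>layer V (Suc k). if A \<subseteq> B then (real (Suc k) - real i) * F A else 0)"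
      by (intro sum.cong) (auto simp: layer_eigen_down[OF F])
    also have "\<dots> = (real (Suc k) - real i) * ?H (Suc k)"
      using V by (simp only: sum_if_scale finite_layer)
    finally show ?thesis .
  qed
  moreover have "(\<Sum>A\<in>layer V k. \<Sum>v\<in>V - A. if insert v A \<subseteq> B then F A else 0) =
      (real l - real k) * ?H k"
  proof -
    have "(\<Sum>A\<in>layer V k. \<Sum>v\<in>V - A. if insert v A \<subseteq> B then F A else 0) =
       (\<Sum>A\<in>layer V k. if A \<subseteq> B then (real l - real k) * F A else 0)"
    proof (intro sum.cong refl)
      fix A assume A: "A \<in> layer V k"
      show "(\<Sum>v\<in>V - A. if insert v A \<subseteq> B then F A else 0) =
              (if A \<subseteq> B then (real l - real k) * F A else 0)"
      proof (cases "A \<subseteq> B")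
        case True
        have "(\<Sum>v\<in>V - A. if insert v A \<subseteq> B then F A else 0) = (\<Sum>v\<in>B - A. F A)"
          using True fB V by (intro sum.mono_neutral_cong_right) auto
        then show ?thesis
          using True A fB real_card_Diff[OF fB(1) True] by (simp add: layer_def)
      next
        case False
        then show ?thesis by (subst sum.neutral) auto
      qed
    qed
    also have "\<dots> = (real l - real k) * ?H k"
      using V by (simp only: sum_if_scale finite_layer)
    finally show ?thesis .
  qed
  ultimately have H: "(real l - real k) * ?H k = (real (Suc k) - real i) * ?H (Suc k)"
    by simp
  have "Suc k * (l choose Suc k) = (l - k) * (l choose k)"
    using binomial_absorption[of k l] binomial_absorb_comp[of l k] by simp
  then have "real (Suc k * (l choose Suc k)) = real ((l - k) * (l choose k))" by simp
  then have C: "(real k + 1) * real (l choose Suc k) = (real l - real k) * real (l choose k)"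
    using step by (simp add: of_nat_diff algebra_simps)
  have U: "(real k + 1) * down_ratio i k l = (real (Suc k) - real i) * down_ratio i (Suc k) l"
    using step by (simp add: down_ratio_def prod.atLeast_Suc_lessThan[of k l] field_simps)
  have pos: "real l - real k > 0" using step by simp
  have "(real l - real k) * (real (l choose k) * down_ratio i k l * F B) =
        real (l choose Suc k) * ((real k + 1) * down_ratio i k l) * F B"
  proof -
    have "(real l - real k) * (real (l choose k) * down_ratio i k l * F B) =
          ((real l - real k) * real (l choose k)) * (down_ratio i k l * F B)" by simp
    then show ?thesis unfolding C[symmetric] by (simp only: mult_ac)
  qed
  also have "\<dots> = (real (Suc k) - real i) * ?H (Suc k)"
    unfolding U step.IH by simp
  also have "\<dots> = (real l - real k) * ?H k" using H by simp
  finally show ?case using pos by (metis mult_left_cancel less_numeral_extra(3))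
qed

section \<open>Averages over nested pairs of sets\<close>

definition layer_mean :: "'a set \<Rightarrow> nat \<Rightarrow> ('a set \<Rightarrow> real) \<Rightarrow> real" where
  "layer_mean V k g = (\<Sum>A\<in>layer V k. g A) / real (card V choose k)"

text \<open>A uniformly random nested pair of sets, one from each layer, couples the uniform distributions on
  the two layers; the denominator counts these pairs.\<close>

definition pair_mean :: "'a set \<Rightarrow> nat \<Rightarrow> nat \<Rightarrow> ('a set \<Rightarrow> 'a set \<Rightarrow> real) \<Rightarrow> real" where
  "pair_mean V k l h = (\<Sum>A\<in>layer V k. \<Sum>B | B \<in> layer V l \<and> A \<subseteq> B. h A B) /
     real ((card V choose k) * ((card V - k) choose (l - k)))"

lemma layer_mean_mono:
  "(\<And>A. A \<in> layer V k \<Longrightarrow> g A \<le> h A) \<Longrightarrow> layer_mean V k g \<le> layer_mean V k h"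
  unfolding layer_mean_def by (intro divide_right_mono sum_mono) auto

lemma layer_mean_nonneg: "(\<And>A. A \<in> layer V k \<Longrightarrow> 0 \<le> g A) \<Longrightarrow> 0 \<le> layer_mean V k g"
  unfolding layer_mean_def by (intro divide_nonneg_nonneg sum_nonneg) auto

lemma layer_mean_cong:
  "(\<And>A. A \<in> layer V k \<Longrightarrow> g A = h A) \<Longrightarrow> layer_mean V k g = layer_mean V k h"
  unfolding layer_mean_def by simp

lemma layer_mean_const: "finite V \<Longrightarrow> k \<le> card V \<Longrightarrow> layer_mean V k (\<lambda>_. c) = c"
  unfolding layer_mean_def by (simp add: card_layer)

lemma layer_mean_add: "layer_mean V k (\<lambda>A. g A + h A) = layer_mean V k g + layer_mean V k h"
  unfolding layer_mean_def by (simp add: sum.distrib add_divide_distrib)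

lemma layer_mean_sum:
  "layer_mean V k (\<lambda>A. \<Sum>i\<in>I. g i A) = (\<Sum>i\<in>I. layer_mean V k (g i))"
  unfolding layer_mean_def by (subst sum.swap) (simp add: sum_divide_distrib)

lemma pair_mean_mono:
  "(\<And>A B. A \<in> layer V k \<Longrightarrow> B \<in> layer V l \<Longrightarrow> g A B \<le> h A B) \<Longrightarrow>
     pair_mean V k l g \<le> pair_mean V k l h"
  unfolding pair_mean_def by (intro divide_right_mono sum_mono) auto

lemma pair_mean_add:
  "pair_mean V k l (\<lambda>A B. g A B + h A B) = pair_mean V k l g + pair_mean V k l h"
  unfolding pair_mean_def by (simp add: sum.distrib add_divide_distrib)

lemma pair_mean_diff:
  "pair_mean V k l (\<lambda>A B. g A B - h A B) = pair_mean V k l g - pair_mean V k l h"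
  unfolding pair_mean_def by (simp add: sum_subtractf diff_divide_distrib)

lemma pair_mean_divide: "pair_mean V k l (\<lambda>A B. g A B / c) = pair_mean V k l g / c"
  unfolding pair_mean_def by (simp add: sum_divide_distrib[symmetric])

lemma pair_mean_sum:
  "pair_mean V k l (\<lambda>A B. \<Sum>i\<in>I. g i A B) = (\<Sum>i\<in>I. pair_mean V k l (g i))"
  by (induction I rule: infinite_finite_induct) (simp_all add: pair_mean_add, simp_all add: pair_mean_def)

lemma pair_mean_mult_upper:
  assumes V: "finite V" and F: "layer_eigen V i F" and kl: "k \<le> l" "l \<le> card V"
  shows "pair_mean V k l (\<lambda>A B. g A * F B) =
           up_ratio (card V) i k l * layer_mean V k (\<lambda>A. g A * F A)"
proof -
  let ?c = "(card V - k) choose (l - k)"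
  have "(\<Sum>A\<in>layer V k. \<Sum>B | B \<in> layer V l \<and> A \<subseteq> B. g A * F B) =
        (\<Sum>A\<in>layer V k. real ?c * up_ratio (card V) i k l * (g A * F A))"
    by (intro sum.cong refl)
       (simp add: sum_distrib_left[symmetric] sum_supersets[OF V F _ kl])
  then have "pair_mean V k l (\<lambda>A B. g A * F B) =
     (real ?c * up_ratio (card V) i k l * (\<Sum>A\<in>layer V k. g A * F A)) /
     (real (card V choose k) * real ?c)"
    unfolding pair_mean_def by (simp add: sum_distrib_left)
  moreover have "real ?c \<noteq> 0" using kl by simp
  ultimately show ?thesis unfolding layer_mean_def by simp
qed

lemma pair_mean_mult_lower:
  assumes V: "finite V" and F: "layer_eigen V i F" and kl: "k \<le> l" "l \<le> card V"
  shows "pair_mean V k l (\<lambda>A B. F A * g B) =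
           down_ratio i k l * layer_mean V l (\<lambda>B. F B * g B)"
proof -
  let ?c = "l choose k"
  have "(\<Sum>A\<in>layer V k. \<Sum>B | B \<in> layer V l \<and> A \<subseteq> B. F A * g B) =
        (\<Sum>B\<in>layer V l. \<Sum>A | A \<in> layer V k \<and> A \<subseteq> B. F A * g B)"
    using V by (intro sum.swap_restrict) auto
  also have "\<dots> = (\<Sum>B\<in>layer V l. real ?c * down_ratio i k l * (F B * g B))"
    by (intro sum.cong refl)
       (simp add: sum_distrib_right[symmetric] sum_subsets[OF V F _ kl(1)])
  finally have "pair_mean V k l (\<lambda>A B. F A * g B) =
     (real ?c * down_ratio i k l * (\<Sum>B\<in>layer V l. F B * g B)) /
     real ((card V choose l) * ?c)"
    unfolding pair_mean_def choose_mult[OF kl] by (simp add: sum_distrib_left)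
  moreover have "real ?c \<noteq> 0" using kl by simp
  ultimately show ?thesis unfolding layer_mean_def by simp
qed

lemma ratio_zero [simp]: "up_ratio n 0 k l = 1" "down_ratio 0 k l = 1"
  by (simp_all add: up_ratio_def down_ratio_def)

text \<open>The marginals of the coupling are uniform: the constant function 1 is harmonic of degree 0.\<close>

lemma pair_mean_fst:
  assumes "finite V" "k \<le> l" "l \<le> card V"
  shows "pair_mean V k l (\<lambda>A B. g A) = layer_mean V k g"
  using pair_mean_mult_upper[OF assms(1) layer_eigen_const[OF assms(1), of 1] assms(2,3), of g] by simp

lemma pair_mean_snd:
  assumes "finite V" "k \<le> l" "l \<le> card V"
  shows "pair_mean V k l (\<lambda>A B. g B) = layer_mean V l g"
  using pair_mean_mult_lower[OF assms(1) layer_eigen_const[OF assms(1), of 1] assms(2,3), of g] by simp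

lemma layer_mean_orthogonal:
  assumes "finite V" "layer_eigen V i F" "layer_eigen V j G" "i \<noteq> j" "i + j \<le> card V" "k \<le> card V"
  shows "layer_mean V k (\<lambda>A. F A * G A) = 0"
  using sum_layer_orthogonal[OF assms] by (simp add: layer_mean_def)

text \<open>Orthogonality on each layer removes the mixed terms, also those of the form $F_i(A) F_j(B)$, since
  averaging over $B$ turns $F_j(B)$ into a multiple of $F_j(A)$.\<close>

lemma pair_mean_square_diff:
  assumes V: "finite V" and F: "\<And>i. i \<le> d \<Longrightarrow> layer_eigen V i (F i)"
    and d: "2 * d \<le> card V" and kl: "k \<le> l" "l \<le> card V"
  shows "pair_mean V k l (\<lambda>A B. ((\<Sum>i\<le>d. F i A) - (\<Sum>i\<le>d. F i B))\<^sup>2) =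
    (\<Sum>i\<le>d. layer_mean V k (\<lambda>A. (F i A)\<^sup>2) + layer_mean V l (\<lambda>A. (F i A)\<^sup>2)
            - 2 * (up_ratio (card V) i k l * layer_mean V k (\<lambda>A. (F i A)\<^sup>2)))"
proof -
  let ?E = "pair_mean V k l"
  define R where "R = (\<lambda>i. layer_mean V k (\<lambda>A. (F i A)\<^sup>2) + layer_mean V l (\<lambda>A. (F i A)\<^sup>2)
            - 2 * (up_ratio (card V) i k l * layer_mean V k (\<lambda>A. (F i A)\<^sup>2)))"
  have summand: "?E (\<lambda>A B. (F i A - F i B) * (F j A - F j B)) = (if i = j then R i else 0)"
    if "i \<le> d" "j \<le> d" for i j
  proof -
    have "?E (\<lambda>A B. (F i A - F i B) * (F j A - F j B)) =
          ?E (\<lambda>A B. F i A * F j A + F i B * F j B - F i A * F j B - F j A * F i B)"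
      by (simp add: algebra_simps)
    also have "\<dots> = layer_mean V k (\<lambda>A. F i A * F j A) + layer_mean V l (\<lambda>A. F i A * F j A)
        - up_ratio (card V) j k l * layer_mean V k (\<lambda>A. F i A * F j A)
        - up_ratio (card V) i k l * layer_mean V k (\<lambda>A. F j A * F i A)"
      by (simp add: pair_mean_diff pair_mean_add pair_mean_mult_upper[OF V F[OF that(1)] kl]
          pair_mean_mult_upper[OF V F[OF that(2)] kl]
          pair_mean_fst[OF V kl, of "\<lambda>A. F i A * F j A"] pair_mean_snd[OF V kl, of "\<lambda>A. F i A * F j A"])
    also have "\<dots> = (if i = j then R i else 0)"
    proof (cases "i = j")
      case True
      then show ?thesis by (simp add: R_def power2_eq_square)
    next
      case False
      then have orth: "layer_mean V m (\<lambda>A. F i A * F j A) = 0" "layer_mean V m (\<lambda>A. F j A * F i A) = 0"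
        if "m \<le> card V" for m
        using layer_mean_orthogonal[OF V F F] \<open>i \<le> d\<close> \<open>j \<le> d\<close> d that by auto
      show ?thesis using False kl by (simp add: orth)
    qed
    finally show ?thesis .
  qed
  have "?E (\<lambda>A B. ((\<Sum>i\<le>d. F i A) - (\<Sum>i\<le>d. F i B))\<^sup>2) =
        ?E (\<lambda>A B. \<Sum>i\<le>d. \<Sum>j\<le>d. (F i A - F i B) * (F j A - F j B))"
    by (simp add: sum_subtractf[symmetric] power2_eq_square sum_product)
  also have "\<dots> = (\<Sum>i\<le>d. \<Sum>j\<le>d. if i = j then R i else 0)"
    unfolding pair_mean_sum by (intro sum.cong refl summand) auto
  also have "\<dots> = (\<Sum>i\<le>d. R i)" by simp
  finally show ?thesis unfolding R_def .
qed

section \<open>Moving between layers changes a harmonic function little\<close>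

lemma prod_one_minus_bounds:
  fixes x :: "'b \<Rightarrow> real"
  assumes "\<And>t. t \<in> I \<Longrightarrow> 0 \<le> x t \<and> x t \<le> 1"
  shows "1 - (\<Sum>t\<in>I. x t) \<le> (\<Prod>t\<in>I. 1 - x t) \<and> (\<Prod>t\<in>I. 1 - x t) \<le> 1"
  using assms
proof (induction I rule: infinite_finite_induct)
  case (insert t I)
  let ?P = "\<Prod>t\<in>I. 1 - x t"
  have P: "1 - (\<Sum>t\<in>I. x t) \<le> ?P" "?P \<le> 1" using insert by auto
  have x: "0 \<le> x t" "x t \<le> 1" using insert.prems by auto
  have "x t * ?P \<le> x t" using P x mult_left_mono[of ?P 1 "x t"] by simp
  moreover have "0 \<le> ?P" using insert.prems by (intro prod_nonneg) auto
  then have "0 \<le> x t * ?P" using x by simp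
  ultimately show ?case using insert.hyps P by (simp add: algebra_simps)
qed auto

lemma ratio_bounds:
  assumes kl: "k \<le> l" "l \<le> n" and M: "0 < M" "M \<le> real k" "M \<le> real n - real l"
    and i: "real i * (real l - real k) / M \<le> 1"
  shows "1 - real i * (real l - real k) / M \<le> up_ratio n i k l" "up_ratio n i k l \<le> 1"
    "1 - real i * (real l - real k) / M \<le> down_ratio i k l" "down_ratio i k l \<le> 1"
proof -
  have le: "real i / D \<le> real i / M" if "M \<le> D" for D
    using that M by (intro divide_left_mono) auto
  have le1: "real i / M \<le> 1" if "t \<in> {k..<l}" for t
  proof -
    have "1 \<le> real l - real k" using that by auto
    then have "real i * 1 \<le> real i * (real l - real k)" by (intro mult_left_mono) auto
    then have "real i / M \<le> real i * (real l - real k) / M" using M by (intro divide_right_mono) auto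
    then show ?thesis using i by linarith
  qed
  have up: "real i / (real n - real t) \<le> real i / M \<and> 0 \<le> real i / (real n - real t)" if "t \<in> {k..<l}" for t
    using that M kl by (intro conjI le) auto
  have dn: "real i / (real t + 1) \<le> real i / M \<and> 0 \<le> real i / (real t + 1)" if "t \<in> {k..<l}" for t
    using that M kl by (intro conjI le) auto
  have S: "(\<Sum>t = k..<l. x t) \<le> real i * (real l - real k) / M"
    if "\<And>t. t \<in> {k..<l} \<Longrightarrow> x t \<le> real i / M" for x
    using sum_mono[of "{k..<l}" x "\<lambda>_. real i / M"] that kl by (simp add: of_nat_diff mult.commute)
  have u: "1 - (\<Sum>t = k..<l. real i / (real n - real t)) \<le> up_ratio n i k l \<and> up_ratio n i k l \<le> 1"
    unfolding up_ratio_def using up order_trans[OF _ le1] by (intro prod_one_minus_bounds) blast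
  have v: "1 - (\<Sum>t = k..<l. real i / (real t + 1)) \<le> down_ratio i k l \<and> down_ratio i k l \<le> 1"
    unfolding down_ratio_def using dn order_trans[OF _ le1] by (intro prod_one_minus_bounds) blast
  show "1 - real i * (real l - real k) / M \<le> up_ratio n i k l" "up_ratio n i k l \<le> 1"
    using u S[of "\<lambda>t. real i / (real n - real t)"] up by auto
  show "1 - real i * (real l - real k) / M \<le> down_ratio i k l" "down_ratio i k l \<le> 1"
    using v S[of "\<lambda>t. real i / (real t + 1)"] dn by auto
qed

text \<open>Here \<open>N\<close> and \<open>N'\<close> stand for the second moments of one homogeneous part on two layers and \<open>u\<close>, \<open>v\<close> for
  the two averaging eigenvalues. Evaluating the correlation of the coupled pair from either layer
  gives \<open>u * N = v * N'\<close>, so eigenvalues near 1 force the moments to be close; the left-hand side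
  is the mean square difference.\<close>

lemma almost_equal_mass:
  fixes N :: real
  assumes "u * N = v * N'" "0 \<le> N" "0 \<le> N'" "1 - b \<le> u" "u \<le> 1" "1 - b \<le> v" "0 \<le> b" "b \<le> 1 / 2"
  shows "N + N' - 2 * (u * N) \<le> 4 * b * N"
proof -
  have "(1 - b) * N' \<le> v * N'" using assms by (intro mult_right_mono) auto
  also have "\<dots> \<le> N" using assms mult_right_mono[of u 1 N] by simp
  finally have "(1 - b) * N' \<le> N" .
  moreover have "1 * N \<le> ((1 - b) * (1 + 2 * b)) * N"
  proof (intro mult_right_mono)
    have "b * (1 - 2 * b) \<ge> 0" using assms by simp
    then show "1 \<le> (1 - b) * (1 + 2 * b)" by (simp add: algebra_simps)
  qed fact
  ultimately have "(1 - b) * N' \<le> (1 - b) * ((1 + 2 * b) * N)" by (simp add: mult.assoc)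
  then have "N' \<le> (1 + 2 * b) * N" using assms by (subst (asm) mult_le_cancel_left_pos) auto
  moreover have "(1 - b) * N \<le> u * N" using assms by (intro mult_right_mono) auto
  ultimately show ?thesis by (simp add: algebra_simps)
qed

text \<open>The second moments on the right may be taken on the lower or on the upper layer. Both versions are
  needed, as the reference layer of weight $pn$ may lie on either side of the other one.\<close>

lemma pair_mean_square_diff_le:
  assumes V: "finite V" and F: "\<And>i. i \<le> d \<Longrightarrow> layer_eigen V i (F i)"
    and d: "2 * d \<le> card V" and kl: "k \<le> l" "l \<le> card V"
    and M: "0 < M" "M \<le> real k" "M \<le> real (card V) - real l"
    and dM: "real d * (real l - real k) / M \<le> 1 / 2" and r: "r = k \<or> r = l"
  shows "pair_mean V k l (\<lambda>A B. ((\<Sum>i\<le>d. F i A) - (\<Sum>i\<le>d. F i B))\<^sup>2) \<le>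
    4 * (real d * (real l - real k) / M) * (\<Sum>i = 1..d. layer_mean V r (\<lambda>A. (F i A)\<^sup>2))"
proof -
  define N where "N = (\<lambda>m i. layer_mean V m (\<lambda>A. (F i A)\<^sup>2))"
  define b where "b = (\<lambda>i. real i * (real l - real k) / M)"
  have bd: "b d = real d * (real l - real k) / M" by (simp add: b_def)
  let ?u = "\<lambda>i. up_ratio (card V) i k l" and ?v = "\<lambda>i. down_ratio i k l"
  have N0: "0 \<le> N m i" for m i unfolding N_def by (intro layer_mean_nonneg) auto
  have bmono: "b i \<le> b d" if "i \<le> d" for i
    unfolding b_def using that M kl by (intro divide_right_mono mult_right_mono) auto
  have summand: "N k i + N l i - 2 * (?u i * N k i) \<le> 4 * b i * N r i" if i: "i \<le> d" for i
  proof -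
    have eq: "?u i * N k i = ?v i * N l i"
      using pair_mean_mult_upper[OF V F[OF i] kl, of "F i"] pair_mean_mult_lower[OF V F[OF i] kl, of "F i"]
      by (simp add: N_def power2_eq_square)
    have b: "0 \<le> b i" "b i \<le> 1 / 2"
      using order_trans[OF bmono[OF i] dM[folded bd]] M kl by (auto simp: b_def)
    have bi: "b i = real i * (real l - real k) / M" by (simp add: b_def)
    have "b i \<le> 1" using b by simp
    note rb = ratio_bounds[OF kl M this[unfolded bi], folded bi]
    from r show ?thesis
    proof
      assume "r = k"
      then show ?thesis using almost_equal_mass[OF eq N0 N0 rb(1,2,3) b] by simp
    next
      assume "r = l"
      then show ?thesis using almost_equal_mass[OF eq[symmetric] N0 N0 rb(3,4,1) b] eq by simp
    qed
  qed
  have "(\<Sum>i\<le>d. N k i + N l i - 2 * (?u i * N k i)) \<le> (\<Sum>i\<le>d. 4 * b i * N r i)"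
    by (intro sum_mono summand) auto
  also have "\<dots> = (\<Sum>i = 1..d. 4 * b i * N r i)"
    by (intro sum.mono_neutral_right) (auto simp: b_def)
  also have "\<dots> \<le> (\<Sum>i = 1..d. 4 * b d * N r i)"
    using bmono N0 by (intro sum_mono mult_right_mono) auto
  finally have "(\<Sum>i\<le>d. N k i + N l i - 2 * (?u i * N k i)) \<le> (\<Sum>i = 1..d. 4 * b d * N r i)" .
  moreover have "pair_mean V k l (\<lambda>A B. ((\<Sum>i\<le>d. F i A) - (\<Sum>i\<le>d. F i B))\<^sup>2) =
      (\<Sum>i\<le>d. N k i + N l i - 2 * (?u i * N k i))"
    unfolding N_def by (rule pair_mean_square_diff[OF V _ d kl]) (rule F)
  ultimately show ?thesis unfolding N_def bd by (simp add: sum_distrib_left)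
qed

text \<open>Markov's inequality for the squared difference of the coupled pair.\<close>

lemma layer_mean_le_shift:
  assumes V: "finite V" and kl: "k \<le> l" "l \<le> card V" and e: "0 < (\<epsilon>::real)"
    and r: "(r = k \<and> s = l) \<or> (r = l \<and> s = k)"
  shows "layer_mean V r (\<lambda>A. of_bool (G A \<le> y)) \<le> layer_mean V s (\<lambda>A. of_bool (G A \<le> y + \<epsilon>)) +
     pair_mean V k l (\<lambda>A B. (G A - G B)\<^sup>2) / \<epsilon>\<^sup>2"
proof -
  \<comment> \<open>If \<open>a \<le> y\<close>, then \<open>b\<close> can only exceed the shifted threshold if the square is at least \<open>\<epsilon>\<^sup>2\<close>.\<close>
  have pt: "of_bool (a \<le> y) \<le> of_bool (b \<le> y + \<epsilon>) + (a - b)\<^sup>2 / \<epsilon>\<^sup>2" for a b :: real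
  proof (cases "a \<le> y \<and> \<not> b \<le> y + \<epsilon>")
    case True
    then have "\<epsilon> \<le> b - a" by simp
    then have "\<epsilon>\<^sup>2 \<le> (b - a)\<^sup>2" using e by (intro power_mono) auto
    then show ?thesis using True e by (simp add: power2_commute[of a b] le_divide_eq)
  qed auto
  from r show ?thesis
  proof
    assume r: "r = k \<and> s = l"
    have "pair_mean V k l (\<lambda>A B. of_bool (G A \<le> y)) \<le>
          pair_mean V k l (\<lambda>A B. of_bool (G B \<le> y + \<epsilon>) + (G A - G B)\<^sup>2 / \<epsilon>\<^sup>2)"
      by (intro pair_mean_mono pt)
    then show ?thesis
      using r by (simp add: pair_mean_add pair_mean_divide pair_mean_fst[OF V kl] pair_mean_snd[OF V kl])
  next
    assume r: "r = l \<and> s = k"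
    have "pair_mean V k l (\<lambda>A B. of_bool (G B \<le> y)) \<le>
          pair_mean V k l (\<lambda>A B. of_bool (G A \<le> y + \<epsilon>) + (G A - G B)\<^sup>2 / \<epsilon>\<^sup>2)"
      by (intro pair_mean_mono) (subst power2_commute, rule pt)
    then show ?thesis
      using r by (simp add: pair_mean_add pair_mean_divide pair_mean_fst[OF V kl] pair_mean_snd[OF V kl])
  qed
qed

text \<open>The part of degree 0 is the mean, and Pythagoras applies to the others.\<close>

lemma layer_variance:
  assumes V: "finite V" and F: "\<And>i. i \<le> d \<Longrightarrow> layer_eigen V i (F i)"
    and d: "2 * d \<le> card V" and k: "k \<le> card V" and F0: "\<And>A. A \<subseteq> V \<Longrightarrow> F 0 A = c"
  defines "G \<equiv> (\<lambda>A. \<Sum>i\<le>d. F i A)"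
  shows "layer_mean V k (\<lambda>A. (G A - layer_mean V k G)\<^sup>2) =
           (\<Sum>i = 1..d. layer_mean V k (\<lambda>A. (F i A)\<^sup>2))"
proof -
  have G: "G A = c + (\<Sum>i = 1..d. F i A)" if "A \<in> layer V k" for A
    using F0[of A] that by (simp add: G_def atMost_atLeast0 sum.atLeast_Suc_atMost layer_def)
  have zero: "layer_mean V k (F i) = 0" if "i \<in> {1..d}" for i
    using layer_mean_orthogonal[OF V F[of i] layer_eigen_const[OF V, of 1], of k] that d k by auto
  have "layer_mean V k G = layer_mean V k (\<lambda>A. c + (\<Sum>i = 1..d. F i A))"
    using G by (rule layer_mean_cong)
  also have "\<dots> = c"
    by (simp add: layer_mean_add layer_mean_const[OF V k] layer_mean_sum zero)
  finally have "layer_mean V k (\<lambda>A. (G A - layer_mean V k G)\<^sup>2) =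
      layer_mean V k (\<lambda>A. \<Sum>i = 1..d. \<Sum>j = 1..d. F i A * F j A)"
    by (intro layer_mean_cong) (simp add: G power2_eq_square sum_product)
  also have "\<dots> = (\<Sum>i = 1..d. \<Sum>j = 1..d. layer_mean V k (\<lambda>A. F i A * F j A))"
    by (simp add: layer_mean_sum)
  also have "\<dots> = (\<Sum>i = 1..d. \<Sum>j = 1..d. if i = j then layer_mean V k (\<lambda>A. (F i A)\<^sup>2) else 0)"
    using layer_mean_orthogonal[OF V F F _ _ k] d
    by (intro sum.cong refl) (auto simp: power2_eq_square)
  finally show ?thesis by simp
qed

section \<open>Passage from polynomials and measures to set functions\<close>

definition set_coeff :: "real_mpoly \<Rightarrow> nat set \<Rightarrow> real" where
  "set_coeff f S = (\<Sum>m | m \<in> Poly_Mapping.keys f \<and> Poly_Mapping.keys m = S. Poly_Mapping.lookup f m)"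

text \<open>The sum in question is the coefficient of the squarefree monomial $x_S$ in $\sum_i \partial f / \partial x_i$:
  a squarefree monomial contributes to it exactly when it is $x_S x_v$ for some $v \notin S$.\<close>

lemma set_coeff_harmonic:
  assumes ml: "multilinear_poly f" and h: "harmonic_poly n f" and S: "S \<subseteq> {1..n}"
  shows "(\<Sum>v\<in>{1..n} - S. set_coeff f (insert v S)) = 0"
proof -
  \<comment> \<open>The squarefree monomial with variable set \<open>S\<close>.\<close>
  define m' :: monomial where "m' = Abs_poly_mapping (\<lambda>j. of_bool (j \<in> S))"
  have "finite S" using S by (rule finite_subset) simp
  then have m': "Poly_Mapping.lookup m' j = of_bool (j \<in> S)" for j
    by (simp add: m'_def)
  have key: "(m - Poly_Mapping.single i 1 = m' \<and> Poly_Mapping.lookup m i \<noteq> 0) \<longleftrightarrow>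
               i \<notin> S \<and> Poly_Mapping.keys m = insert i S"
    if m: "\<And>j. Poly_Mapping.lookup m j \<le> 1" for m :: monomial and i
  proof
    assume L: "m - Poly_Mapping.single i 1 = m' \<and> Poly_Mapping.lookup m i \<noteq> 0"
    then have mi: "Poly_Mapping.lookup m i = 1" using m[of i] by simp
    have e: "Poly_Mapping.lookup m j - (1 when i = j) = of_bool (j \<in> S)" for j
      using L m'[of j] by (auto simp: lookup_minus lookup_single)
    have "i \<notin> S" using e[of i] mi by auto
    moreover have "j \<in> Poly_Mapping.keys m \<longleftrightarrow> j \<in> insert i S" for j
      using e[of j] mi by (cases "i = j") (auto simp: in_keys_iff)
    ultimately show "i \<notin> S \<and> Poly_Mapping.keys m = insert i S" by blast
  next
    assume R: "i \<notin> S \<and> Poly_Mapping.keys m = insert i S"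
    have lm: "Poly_Mapping.lookup m j = of_bool (j \<in> insert i S)" for j
    proof (cases "j \<in> insert i S")
      case True
      then have "j \<in> Poly_Mapping.keys m" using R by simp
      then have "Poly_Mapping.lookup m j \<noteq> 0" unfolding in_keys_iff .
      then show ?thesis using m[of j] True by simp
    next
      case False
      then have "j \<notin> Poly_Mapping.keys m" using R by simp
      then show ?thesis using False by (simp add: in_keys_iff)
    qed
    have "m - Poly_Mapping.single i 1 = m'"
      using R by (intro poly_mapping_eqI) (auto simp: lookup_minus lookup_single lm m' when_def)
    then show "m - Poly_Mapping.single i 1 = m' \<and> Poly_Mapping.lookup m i \<noteq> 0"
      using lm[of i] by simp
  qed
  have pd: "Poly_Mapping.lookup (partial_deriv i f) m' = (if i \<in> S then 0 else set_coeff f (insert i S))" for i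
  proof -
    have "Poly_Mapping.lookup (partial_deriv i f) m' =
      (\<Sum>m\<in>Poly_Mapping.keys f. if i \<notin> S \<and> Poly_Mapping.keys m = insert i S then Poly_Mapping.lookup f m else 0)"
      unfolding partial_deriv_def lookup_sum
    proof (intro sum.cong refl)
      fix m assume "m \<in> Poly_Mapping.keys f"
      then have m: "Poly_Mapping.lookup m j \<le> 1" for j using ml by (auto simp: multilinear_poly_def)
      have "Poly_Mapping.lookup m i \<noteq> 0 \<Longrightarrow> Poly_Mapping.lookup m i = 1" using m[of i] by simp
      then show "Poly_Mapping.lookup (Poly_Mapping.single (m - Poly_Mapping.single i 1)
              (real (Poly_Mapping.lookup m i) * Poly_Mapping.lookup f m)) m' =
            (if i \<notin> S \<and> Poly_Mapping.keys m = insert i S then Poly_Mapping.lookup f m else 0)"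
        unfolding key[OF m, symmetric] by (auto simp: lookup_single when_def)
    qed
    then show ?thesis by (simp add: set_coeff_def sum.inter_filter)
  qed
  have "0 = (\<Sum>i = 1..n. Poly_Mapping.lookup (partial_deriv i f) m')"
    using h unfolding harmonic_poly_def by (metis lookup_sum lookup_zero)
  also have "\<dots> = (\<Sum>i\<in>{1..n} - S. set_coeff f (insert i S))"
    by (intro sum.mono_neutral_cong_right) (auto simp: pd)
  finally show ?thesis by simp
qed

definition indicator_point :: "nat set \<Rightarrow> nat \<Rightarrow> nat" where
  "indicator_point A i = of_bool (i \<in> A)"

text \<open>A monomial is 1 at the indicator of \<open>A\<close> if its variables lie in \<open>A\<close>, and 0 otherwise. Grouping the
  monomials by their sets of variables and these by size gives the homogeneous parts.\<close>

lemma cube_eval_indicator_point: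
  assumes ml: "multilinear_poly f" and A: "finite A"
  shows "cube_eval f (indicator_point A) = (\<Sum>i\<le>poly_degree f. \<Sum>S\<in>layer A i. set_coeff f S)"
proof -
  let ?K = "Poly_Mapping.keys f"
  let ?k = "Poly_Mapping.keys :: monomial \<Rightarrow> nat set"
  have mon: "(\<Prod>i\<in>?k m. real (indicator_point A i) ^ Poly_Mapping.lookup m i) = of_bool (?k m \<subseteq> A)" for m
  proof (cases "?k m \<subseteq> A")
    case True
    then show ?thesis by (auto simp: indicator_point_def intro!: prod.neutral)
  next
    case False
    then obtain i where "i \<in> ?k m" "i \<notin> A" by blast
    then show ?thesis
      using False by (auto simp: indicator_point_def in_keys_iff intro!: prod_zero bexI[of _ i])
  qed
  have deg: "card (?k m) \<le> poly_degree f" if m: "m \<in> ?K" for m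
  proof -
    have "(\<Sum>i\<in>?k m. 1) \<le> (\<Sum>i\<in>?k m. Poly_Mapping.lookup m i)"
      by (intro sum_mono) (simp add: in_keys_iff)
    then have "card (?k m) \<le> monomial_degree m" by (simp add: monomial_degree_def)
    also have "\<dots> \<le> poly_degree f"
      unfolding poly_degree_def using m by (intro Max_ge) auto
    finally show ?thesis .
  qed
  have big: "set_coeff f S = 0" if "\<not> card S \<le> poly_degree f" for S
  proof -
    have "{m. m \<in> ?K \<and> ?k m = S} = {}" using deg that by auto
    then show ?thesis by (simp only: set_coeff_def sum.empty)
  qed
  have "cube_eval f (indicator_point A) = (\<Sum>m\<in>?K. if ?k m \<subseteq> A then Poly_Mapping.lookup f m else 0)"
    unfolding cube_eval_def poly_eval_def mon by (intro sum.cong) auto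
  also have "\<dots> = (\<Sum>m | m \<in> ?K \<and> ?k m \<in> Pow A. Poly_Mapping.lookup f m)"
    by (simp add: sum.inter_filter)
  also have "\<dots> = (\<Sum>S\<in>Pow A. \<Sum>m | m \<in> {m. m \<in> ?K \<and> ?k m \<in> Pow A} \<and> ?k m = S. Poly_Mapping.lookup f m)"
    using A by (subst sum.group) auto
  also have "\<dots> = (\<Sum>S\<in>Pow A. set_coeff f S)"
    unfolding set_coeff_def by (intro sum.cong refl) auto
  also have "\<dots> = (\<Sum>S | S \<in> Pow A \<and> card S \<in> {..poly_degree f}. set_coeff f S)"
    using A big by (intro sum.mono_neutral_right) auto
  also have "\<dots> = (\<Sum>i\<le>poly_degree f. \<Sum>S | S \<in> {S. S \<in> Pow A \<and> card S \<in> {..poly_degree f}} \<and> card S = i. set_coeff f S)"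
    using A by (subst sum.group) auto
  also have "\<dots> = (\<Sum>i\<le>poly_degree f. \<Sum>S\<in>layer A i. set_coeff f S)"
    by (intro sum.cong refl) (auto simp: layer_def)
  finally show ?thesis .
qed

lemma mem_cube_iff: "x \<in> cube n \<longleftrightarrow> (\<forall>i. x i = 0 \<or> x i = 1 \<and> i \<in> {1..n})"
  unfolding cube_def PiE_dflt_def by blast

lemma bij_indicator_point: "bij_betw indicator_point (layer {1..n} m) (slice n m)"
proof (rule bij_betw_byWitness[where f' = "\<lambda>x. {i. x i = 1}"])
  show "indicator_point ` layer {1..n} m \<subseteq> slice n m"
  proof
    fix x assume "x \<in> indicator_point ` layer {1..n} m"
    then obtain A where A: "x = indicator_point A" "A \<subseteq> {1..n}" "card A = m" by (auto simp: layer_def)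
    have "(\<Sum>i = 1..n. x i) = (\<Sum>i\<in>A. 1)"
      using A by (intro sum.mono_neutral_cong_right) (auto simp: indicator_point_def)
    moreover have "x \<in> cube n"
      using A by (auto simp: mem_cube_iff indicator_point_def)
    ultimately show "x \<in> slice n m" using A by (simp add: slice_def)
  qed
  show "(\<lambda>x. {i. x i = 1}) ` slice n m \<subseteq> layer {1..n} m"
  proof
    fix A assume "A \<in> (\<lambda>x. {i. x i = 1}) ` slice n m"
    then obtain x where x: "A = {i. x i = 1}" "x \<in> cube n" "(\<Sum>i = 1..n. x i) = m"
      by (auto simp: slice_def)
    have A: "A \<subseteq> {1..n}" using x(1,2) unfolding mem_cube_iff by (metis (mono_tags) mem_Collect_eq subsetI zero_neq_one)
    have "(\<Sum>i = 1..n. x i) = (\<Sum>i\<in>A. 1)"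
    proof (intro sum.mono_neutral_cong_right)
      show "\<forall>i\<in>{1..n} - A. x i = 0" using x(1,2) unfolding mem_cube_iff by blast
    qed (use A x(1) in auto)
    then show "A \<in> layer {1..n} m" using A x by (simp add: layer_def)
  qed
  show "\<forall>x\<in>slice n m. indicator_point {i. x i = 1} = x"
  proof
    fix x assume "x \<in> slice n m"
    then have x: "x i = 0 \<or> x i = 1" for i unfolding slice_def mem_cube_iff by blast
    show "indicator_point {i. x i = 1} = x"
    proof
      show "indicator_point {i. x i = 1} i = x i" for i
        using x[of i] by (auto simp: indicator_point_def)
    qed
  qed
qed (auto simp: indicator_point_def)

lemma expectation_slice_measure:
  assumes "k \<le> n"
  shows "measure_pmf.expectation (slice_measure n k) g = layer_mean {1..n} k (\<lambda>A. g (indicator_point A))"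
proof -
  have "card (slice n k) = n choose k"
    using bij_betw_same_card[OF bij_indicator_point, of n k] by (simp add: card_layer)
  moreover have "sum g (slice n k) = (\<Sum>A\<in>layer {1..n} k. g (indicator_point A))"
    by (rule sum.reindex_bij_betw[OF bij_indicator_point, symmetric])
  ultimately show ?thesis
    unfolding slice_measure_def layer_mean_def
    using integral_pmf_of_set[OF slice_nonempty[OF assms] finite_slice] by simp
qed

lemma prob_slice_measure:
  assumes "k \<le> n"
  shows "measure_pmf.prob (slice_measure n k) {x. Q x} =
           layer_mean {1..n} k (\<lambda>A. of_bool (Q (indicator_point A)))"
proof -
  have "measure_pmf.prob (slice_measure n k) {x. Q x} =
          measure_pmf.expectation (slice_measure n k) (indicator {x. Q x})" by simp
  also have "\<dots> = layer_mean {1..n} k (\<lambda>A. of_bool (Q (indicator_point A)))"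
    unfolding expectation_slice_measure[OF assms] by (simp add: indicator_def)
  finally show ?thesis .
qed

text \<open>Conditioned on its weight $m$, which is binomial, a point of the cube is uniform on slice $m$. The
  Bernstein polynomials are the binomial weights.\<close>

lemma prob_product_measure:
  assumes p: "0 < p" "p < 1"
  shows "measure_pmf.prob (product_measure n p) {x. Q x} =
           (\<Sum>m\<le>n. Bernstein n m p * layer_mean {1..n} m (\<lambda>A. of_bool (Q (indicator_point A))))"
proof -
  have fc: "finite (cube n)"
    unfolding cube_def by (intro finite_PiE_dflt) auto
  have wt: "(\<Sum>i = 1..n. x i) \<le> n" "(\<Sum>i = 1..n. 1 - x i) = n - (\<Sum>i = 1..n. x i)" if "x \<in> cube n" for x
  proof -
    have le: "x i \<le> 1" if "i \<in> {1..n}" for i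
    proof -
      have "x i = 0 \<or> x i = 1" using \<open>x \<in> cube n\<close> unfolding mem_cube_iff by blast
      then show ?thesis by auto
    qed
    show "(\<Sum>i = 1..n. x i) \<le> n" using sum_mono[of "{1..n}" x "\<lambda>_. 1", OF le] by simp
    show "(\<Sum>i = 1..n. 1 - x i) = n - (\<Sum>i = 1..n. x i)"
    proof -
      have "(\<Sum>i = 1..n. 1 - x i) + (\<Sum>i = 1..n. x i) = (\<Sum>i = 1..n. 1)"
        unfolding sum.distrib[symmetric] by (intro sum.cong refl le_add_diff_inverse2 le)
      then show ?thesis by simp
    qed
  qed
  have out: "pmf (product_measure n p) x = 0" if "x \<notin> cube n" for x
  proof -
    let ?B = "map_pmf of_bool (bernoulli_pmf p) :: nat pmf"
    have "set_pmf ?B \<subseteq> {0, 1}" by auto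
    then have "PiE_dflt {1..n} 0 (set_pmf \<circ> (\<lambda>_. ?B)) \<subseteq> cube n"
      unfolding cube_def PiE_dflt_def comp_def by blast
    moreover have "set_pmf (product_measure n p) \<subseteq> PiE_dflt {1..n} 0 (set_pmf \<circ> (\<lambda>_. ?B))"
      unfolding product_measure_def by (rule set_Pi_pmf_subset') simp
    ultimately have "set_pmf (product_measure n p) \<subseteq> cube n" by (rule order_trans[rotated])
    then show ?thesis using that by (auto simp: set_pmf_iff)
  qed
  have "measure_pmf.prob (product_measure n p) {x. Q x} =
          measure_pmf.prob (product_measure n p) {x. x \<in> cube n \<and> Q x}"
    by (rule measure_prob_cong_0) (auto simp: out)
  also have "\<dots> = (\<Sum>x | x \<in> cube n \<and> Q x. pmf (product_measure n p) x)"
    using fc by (intro measure_measure_pmf_finite) simp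
  also have "\<dots> = (\<Sum>x\<in>cube n. if Q x then pmf (product_measure n p) x else 0)"
    using fc by (simp add: sum.inter_filter)
  also have "\<dots> = (\<Sum>m\<le>n. \<Sum>x | x \<in> cube n \<and> (\<Sum>i = 1..n. x i) = m.
                     if Q x then pmf (product_measure n p) x else 0)"
    using fc wt by (subst sum.group) auto
  also have "\<dots> = (\<Sum>m\<le>n. \<Sum>x\<in>slice n m. p ^ m * (1 - p) ^ (n - m) * of_bool (Q x))"
    unfolding slice_def using wt
    by (intro sum.cong refl) (auto simp: pmf_product_measure[OF p])
  also have "\<dots> = (\<Sum>m\<le>n. \<Sum>A\<in>layer {1..n} m. p ^ m * (1 - p) ^ (n - m) * of_bool (Q (indicator_point A)))"
    by (intro sum.cong refl sum.reindex_bij_betw[OF bij_indicator_point, symmetric])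
  also have "\<dots> = (\<Sum>m\<le>n. Bernstein n m p * layer_mean {1..n} m (\<lambda>A. of_bool (Q (indicator_point A))))"
    by (intro sum.cong refl) (simp add: layer_mean_def Bernstein_def sum_distrib_left[symmetric])
  finally show ?thesis .
qed

lemma sum_Bernstein_variance:
  "(\<Sum>m\<le>n. Bernstein n m p * (real m - real n * p)\<^sup>2) = real n * p * (1 - p)"
proof -
  have "(\<Sum>m\<le>n. Bernstein n m p * (real m - real n * p)\<^sup>2) =
        (\<Sum>m\<le>n. real m * (real m - 1) * Bernstein n m p) +
        (1 - 2 * real n * p) * (\<Sum>m\<le>n. real m * Bernstein n m p) +
        (real n * p)\<^sup>2 * (\<Sum>m\<le>n. Bernstein n m p)"
    by (simp add: sum_distrib_left sum.distrib[symmetric] algebra_simps power2_eq_square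
        del: sum_Bernstein sum_k_Bernstein sum_kk_Bernstein)
  also have "\<dots> = real n * p * (1 - p)"
    unfolding sum_kk_Bernstein sum_k_Bernstein sum_Bernstein by (simp add: algebra_simps power2_eq_square)
  finally show ?thesis .
qed

section \<open>Comparison of distribution functions\<close>

lemma layers_close:
  assumes V: "finite V" and F: "\<And>i. i \<le> d \<Longrightarrow> layer_eigen V i (F i)"
    and d: "2 * d \<le> card V" and km: "k \<le> card V" "m \<le> card V"
    and M: "0 < M" "M \<le> real k" "M \<le> real m" "M \<le> real (card V) - real k" "M \<le> real (card V) - real m"
    and dM: "real d * \<bar>real m - real k\<bar> / M \<le> 1 / 2" and e: "0 < \<epsilon>"
    and var: "(\<Sum>i = 1..d. layer_mean V k (\<lambda>A. (F i A)\<^sup>2)) = 1"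
    and rs: "(r = k \<and> s = m) \<or> (r = m \<and> s = k)"
  shows "layer_mean V r (\<lambda>A. of_bool ((\<Sum>i\<le>d. F i A) \<le> y)) \<le>
         layer_mean V s (\<lambda>A. of_bool ((\<Sum>i\<le>d. F i A) \<le> y + \<epsilon>)) +
           4 * (real d * \<bar>real m - real k\<bar> / M) / \<epsilon>\<^sup>2"
proof -
  let ?G = "\<lambda>A. \<Sum>i\<le>d. F i A"
  define a where "a = min k m"
  define b where "b = max k m"
  have ab: "a \<le> b" "b \<le> card V" "M \<le> real a" "M \<le> real (card V) - real b"
    "\<bar>real m - real k\<bar> = real b - real a" "k = a \<or> k = b" "(r = a \<and> s = b) \<or> (r = b \<and> s = a)"
    using km M rs by (auto simp: a_def b_def min_def max_def)
  have "pair_mean V a b (\<lambda>A B. (?G A - ?G B)\<^sup>2) \<le> 4 * (real d * (real b - real a) / M) * 1"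
    using pair_mean_square_diff_le[OF V F d ab(1,2) M(1) ab(3,4) _ ab(6)] dM ab(5) var by simp
  then have "pair_mean V a b (\<lambda>A B. (?G A - ?G B)\<^sup>2) / \<epsilon>\<^sup>2 \<le> 4 * (real d * \<bar>real m - real k\<bar> / M) / \<epsilon>\<^sup>2"
    using ab(5) by (intro divide_right_mono) auto
  then show ?thesis
    using layer_mean_le_shift[OF V ab(1,2) e ab(7), of ?G y] by linarith
qed

lemma layer_mean_of_bool_bounds:
  assumes "finite V" "k \<le> card V"
  shows "0 \<le> layer_mean V k (\<lambda>A. of_bool (Q A))" "layer_mean V k (\<lambda>A. of_bool (Q A)) \<le> 1"
  using layer_mean_mono[of V k "\<lambda>A. of_bool (Q A)" "\<lambda>_. 1"] layer_mean_const[OF assms, of 1]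
  by (auto intro: layer_mean_nonneg)

text \<open>Layers at distance at most \<open>T\<close> from layer $k$ are compared through the coupling; there
  \<open>s2 / 2\<close> is a lower bound for the distance of both layers from the ends of the lattice. The
  remaining layers have total binomial weight at most \<open>s2 / T\<^sup>2\<close> by Chebyshev's inequality.\<close>

lemma binomial_mixture_close:
  assumes V: "finite V" and F: "\<And>i. i \<le> d \<Longrightarrow> layer_eigen V i (F i)"
    and d: "2 * d \<le> card V" and p: "0 < p" "p < 1" "p * real (card V) = real k"
    and var: "(\<Sum>i = 1..d. layer_mean V k (\<lambda>A. (F i A)\<^sup>2)) = 1"
    and \<sigma>2: "s2 = p * (1 - p) * real (card V)"
    and T: "0 < T" "2 * T \<le> s2" "4 * real d * T \<le> s2" and e: "0 < \<epsilon>"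
  defines "P \<equiv> (\<lambda>m y. layer_mean V m (\<lambda>A. of_bool ((\<Sum>i\<le>d. F i A) \<le> y)))"
  defines "\<eta> \<equiv> 8 * (real d * T / s2) / \<epsilon>\<^sup>2 + s2 / T\<^sup>2"
  shows "P k (y - \<epsilon>) - \<eta> \<le> (\<Sum>m\<le>card V. Bernstein (card V) m p * P m y)"
    "(\<Sum>m\<le>card V. Bernstein (card V) m p * P m y) \<le> P k (y + \<epsilon>) + \<eta>"
proof -
  let ?n = "card V"
  let ?w = "\<lambda>m. Bernstein ?n m p"
  \<comment> \<open>One bound for all layers: the first term serves the close layers, the second is at least 1
      on the far ones, and its binomial mean is the Chebyshev bound.\<close>
  let ?b = "\<lambda>m. 8 * (real d * T / s2) / \<epsilon>\<^sup>2 + (real m - real k)\<^sup>2 / T\<^sup>2"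
  have s2: "0 < s2" using T by linarith
  have nk: "real ?n - real k = (1 - p) * real ?n" using p(3) by (simp add: algebra_simps)
  have pk: "s2 = (1 - p) * real k" using p(3) \<sigma>2 by (simp add: mult_ac)
  have s2nk: "s2 = p * (real ?n - real k)" unfolding nk \<sigma>2 by simp
  have nk0: "0 \<le> real ?n - real k" unfolding nk using p by simp
  have bk: "s2 \<le> real k" unfolding pk using p mult_right_mono[of "1 - p" 1 "real k"] by simp
  have bnk: "s2 \<le> real ?n - real k"
    unfolding s2nk using p nk0 mult_right_mono[of p 1 "real ?n - real k"] by simp
  have kn: "k \<le> ?n" using nk0 by simp
  have close: "P r z \<le> P s (z + \<epsilon>) + ?b m"
    if m: "m \<le> ?n" and rs: "(r = k \<and> s = m) \<or> (r = m \<and> s = k)" for m r s z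
  proof (cases "\<bar>real m - real k\<bar> \<le> T")
    case True
    let ?M = "s2 / 2"
    have "real d * \<bar>real m - real k\<bar> \<le> real d * T" using True by (intro mult_left_mono) auto
    then have dT: "real d * \<bar>real m - real k\<bar> / ?M \<le> real d * T / ?M"
      using s2 by (intro divide_right_mono) auto
    have half: "real d * T / ?M \<le> 1 / 2" using T(3) s2 by (simp add: field_simps)
    have "P r z \<le> P s (z + \<epsilon>) + 4 * (real d * \<bar>real m - real k\<bar> / ?M) / \<epsilon>\<^sup>2"
      unfolding P_def
      by (rule layers_close[OF V F d kn m _ _ _ _ _ order_trans[OF dT half] e var rs])
         (use s2 bk bnk True T(2) in auto)
    also have "4 * (real d * \<bar>real m - real k\<bar> / ?M) / \<epsilon>\<^sup>2 \<le> 4 * (real d * T / ?M) / \<epsilon>\<^sup>2"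
      by (intro divide_right_mono mult_left_mono[OF dT]) auto
    also have "\<dots> \<le> ?b m" by simp
    finally show ?thesis by simp
  next
    case False
    then have "T\<^sup>2 \<le> \<bar>real m - real k\<bar>\<^sup>2" using T by (intro power_mono) auto
    then have "1 \<le> (real m - real k)\<^sup>2 / T\<^sup>2" using T by simp
    moreover have "0 \<le> 8 * (real d * T / s2) / \<epsilon>\<^sup>2" using T s2 by simp
    moreover have "P r z \<le> 1" "0 \<le> P s (z + \<epsilon>)"
      unfolding P_def using rs m kn V by (auto intro: layer_mean_of_bool_bounds)
    ultimately show ?thesis by linarith
  qed
  have w0: "0 \<le> ?w m" for m using p by (intro Bernstein_nonneg) auto
  have "(\<Sum>m\<le>?n. ?w m * ?b m) =
      (\<Sum>m\<le>?n. ?w m) * (8 * (real d * T / s2) / \<epsilon>\<^sup>2) + (\<Sum>m\<le>?n. ?w m * (real m - real k)\<^sup>2) / T\<^sup>2"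
    unfolding sum_distrib_right sum_divide_distrib sum.distrib[symmetric] by (simp add: distrib_left)
  also have "\<dots> = \<eta>"
    using sum_Bernstein_variance[of ?n p] p(3) \<sigma>2 by (simp add: \<eta>_def mult_ac)
  finally have b: "(\<Sum>m\<le>?n. ?w m * ?b m) = \<eta>" .
  have const: "c + \<eta> = (\<Sum>m\<le>?n. ?w m * (c + ?b m))" for c
    unfolding b[symmetric] distrib_left sum.distrib sum_distrib_right[symmetric] by simp
  have "(\<Sum>m\<le>?n. ?w m * P m y) \<le> (\<Sum>m\<le>?n. ?w m * (P k (y + \<epsilon>) + ?b m))"
    using w0 by (intro sum_mono mult_left_mono close) auto
  then show "(\<Sum>m\<le>?n. ?w m * P m y) \<le> P k (y + \<epsilon>) + \<eta>" unfolding const .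
  have "P k (y - \<epsilon>) = (\<Sum>m\<le>?n. ?w m * P k (y - \<epsilon>))" by (simp add: sum_distrib_right[symmetric])
  also have "\<dots> \<le> (\<Sum>m\<le>?n. ?w m * (P m y + ?b m))"
    using w0 close[where r = k and z = "y - \<epsilon>"] by (intro sum_mono mult_left_mono) auto
  also have "\<dots> = (\<Sum>m\<le>?n. ?w m * P m y) + \<eta>"
    unfolding b[symmetric] by (simp add: distrib_left sum.distrib)
  finally show "P k (y - \<epsilon>) - \<eta> \<le> (\<Sum>m\<le>?n. ?w m * P m y)" by simp
qed

lemma levy_distance_distr_le:
  assumes "0 < \<epsilon>"
    and "\<And>y. measure_pmf.prob M {x. X x \<le> y - \<epsilon>} - \<epsilon> \<le> measure_pmf.prob N {x. Y x \<le> y}"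
    and "\<And>y. measure_pmf.prob N {x. Y x \<le> y} \<le> measure_pmf.prob M {x. X x \<le> y + \<epsilon>} + \<epsilon>"
  shows "levy_distance (distr (measure_pmf M) borel X) (distr (measure_pmf N) borel Y) \<le> \<epsilon>"
proof -
  have cdf: "cdf (distr (measure_pmf M) borel X) y = measure_pmf.prob M {x. X x \<le> y}" for M :: "'c pmf" and X y
    by (simp add: cdf_def measure_distr vimage_def)
  show ?thesis
    unfolding levy_distance_def cdf using assms
    by (intro cInf_lower) (auto intro!: bdd_belowI[of _ 0])
qed

text \<open>The comparison of the mixture, applied to the homogeneous parts of the polynomial. The bound
  \<open>1 \<le> T\<close> makes the degree at most $n/4$, so that all the parts are mutually orthogonal.\<close>

lemma slice_cube_close:
  assumes p: "0 < p" "p < 1" "p * real n = real k"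
    and ml: "multilinear_poly f" and h: "harmonic_poly n f" and deg: "poly_degree f = d"
    and var: "measure_pmf.variance (slice_measure n k) (cube_eval f) = 1"
    and \<sigma>: "s2 = p * (1 - p) * real n"
    and T: "0 < T" "2 * T \<le> s2" "4 * real d * T \<le> s2" "1 \<le> T" and e: "0 < \<epsilon>"
  defines "\<eta> \<equiv> 8 * (real d * T / s2) / \<epsilon>\<^sup>2 + s2 / T\<^sup>2"
  shows "measure_pmf.prob (slice_measure n k) {x. cube_eval f x \<le> y - \<epsilon>} - \<eta> \<le>
           measure_pmf.prob (product_measure n p) {x. cube_eval f x \<le> y}"
    "measure_pmf.prob (product_measure n p) {x. cube_eval f x \<le> y} \<le>
       measure_pmf.prob (slice_measure n k) {x. cube_eval f x \<le> y + \<epsilon>} + \<eta>"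
proof -
  let ?V = "{1..n}"
  define F where "F = (\<lambda>i A. \<Sum>S\<in>layer A i. set_coeff f S)"
  let ?G = "\<lambda>A. \<Sum>i\<le>d. F i A"
  have F: "layer_eigen ?V i (F i)" for i
    unfolding F_def by (rule layer_eigen_homogeneous) (simp, rule set_coeff_harmonic[OF ml h])
  have G: "cube_eval f (indicator_point A) = ?G A" if "A \<in> layer ?V m" for A m
    using cube_eval_indicator_point[OF ml, of A] that deg
    by (auto simp: F_def layer_def intro: finite_subset)
  have "real k \<le> 1 * real n" unfolding p(3)[symmetric] using p by (intro mult_right_mono) auto
  then have kn: "k \<le> n" by simp
  have "real d * 1 \<le> real d * T" using T by (intro mult_left_mono) auto
  moreover have "s2 \<le> 1 * 1 * real n" unfolding \<sigma> using p by (intro mult_mono) auto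
  ultimately have "4 * real d \<le> real n" using T by linarith
  then have d: "2 * d \<le> card ?V" by simp
  have F0: "F 0 A = set_coeff f {}" if "A \<subseteq> ?V" for A
  proof -
    have "layer A 0 = {{}}" using that by (auto simp: layer_def finite_subset[of _ ?V])
    then show ?thesis by (simp add: F_def)
  qed
  have mean: "layer_mean ?V m (\<lambda>A. g (cube_eval f (indicator_point A))) = layer_mean ?V m (\<lambda>A. g (?G A))"
    for m and g :: "real \<Rightarrow> real"
    by (intro layer_mean_cong) (simp add: G)
  have var1: "(\<Sum>i = 1..d. layer_mean ?V k (\<lambda>A. (F i A)\<^sup>2)) = 1"
  proof -
    have "(\<Sum>i = 1..d. layer_mean ?V k (\<lambda>A. (F i A)\<^sup>2)) =
          layer_mean ?V k (\<lambda>A. (?G A - layer_mean ?V k ?G)\<^sup>2)"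
      by (rule layer_variance[symmetric]) (use F F0 d kn in auto)
    also have "\<dots> = layer_mean ?V k (\<lambda>A. (cube_eval f (indicator_point A) -
                      layer_mean ?V k (\<lambda>A. cube_eval f (indicator_point A)))\<^sup>2)"
      using mean[of k "\<lambda>x. x"] mean[of k "\<lambda>x. (x - layer_mean ?V k ?G)\<^sup>2"] by simp
    also have "\<dots> = 1" using var by (simp add: expectation_slice_measure[OF kn])
    finally show ?thesis .
  qed
  have slice: "measure_pmf.prob (slice_measure n k) {x. cube_eval f x \<le> z} =
      layer_mean ?V k (\<lambda>A. of_bool (?G A \<le> z))" for z
    unfolding prob_slice_measure[OF kn] by (rule mean[of k "\<lambda>x. of_bool (x \<le> z)"])
  have cube: "measure_pmf.prob (product_measure n p) {x. cube_eval f x \<le> y} =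
      (\<Sum>m\<le>card ?V. Bernstein (card ?V) m p * layer_mean ?V m (\<lambda>A. of_bool (?G A \<le> y)))"
    unfolding prob_product_measure[OF p(1,2)] using mean[of _ "\<lambda>x. of_bool (x \<le> y)"] by simp
  have pV: "p * real (card ?V) = real k" "s2 = p * (1 - p) * real (card ?V)" using p(3) \<sigma> by simp_all
  note main = binomial_mixture_close[OF _ F d p(1,2) pV(1) var1 pV(2) T(1-3) e, of y]
  show "measure_pmf.prob (slice_measure n k) {x. cube_eval f x \<le> y - \<epsilon>} - \<eta> \<le>
           measure_pmf.prob (product_measure n p) {x. cube_eval f x \<le> y}"
    unfolding slice cube \<eta>_def by (rule main(1)) simp
  show "measure_pmf.prob (product_measure n p) {x. cube_eval f x \<le> y} \<le>
       measure_pmf.prob (slice_measure n k) {x. cube_eval f x \<le> y + \<epsilon>} + \<eta>"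
    unfolding slice cube \<eta>_def by (rule main(2)) simp
qed

lemma poly_degree_pos_of_variance:
  assumes ml: "multilinear_poly f" and k: "k \<le> n"
    and var: "measure_pmf.variance (slice_measure n k) (cube_eval f) \<noteq> 0"
  shows "0 < poly_degree f"
proof (rule ccontr)
  assume "\<not> 0 < poly_degree f"
  then have d: "poly_degree f = 0" by simp
  have c: "cube_eval f (indicator_point A) = set_coeff f {}" if A: "A \<in> layer {1..n} k" for A
  proof -
    have "finite A" using A by (auto simp: layer_def intro: finite_subset)
    moreover have "layer A 0 = {{}}"
      using \<open>finite A\<close> by (auto simp: layer_def dest: finite_subset)
    ultimately show ?thesis using cube_eval_indicator_point[OF ml, of A] d by simp
  qed
  have "layer_mean {1..n} k (\<lambda>A. cube_eval f (indicator_point A)) = layer_mean {1..n} k (\<lambda>_. set_coeff f {})"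
    using c by (rule layer_mean_cong)
  also have "\<dots> = set_coeff f {}" using k by (intro layer_mean_const) auto
  finally have m: "layer_mean {1..n} k (\<lambda>A. cube_eval f (indicator_point A)) = set_coeff f {}" .
  have "layer_mean {1..n} k (\<lambda>A. (cube_eval f (indicator_point A) - set_coeff f {})\<^sup>2) =
          layer_mean {1..n} k (\<lambda>_. 0)"
    using c by (intro layer_mean_cong) simp
  also have "\<dots> = 0" using k by (intro layer_mean_const) auto
  finally show False using var unfolding expectation_slice_measure[OF k] m by simp
qed

theorem corollary4p7:
  shows "\<exists>K C :: real. K > 0 \<and> C > 0 \<and>
    (\<forall>(n::nat) (p::real) (k::nat) (f::real_mpoly) (d::nat).
       n \<ge> 1 \<longrightarrow> 0 < p \<longrightarrow> p < 1 \<longrightarrow>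
       p * real n = real k \<longrightarrow>
       p * (1 - p) * real n \<ge> 3 * ln (real n) \<longrightarrow>
       poly_in_vars n f \<longrightarrow> multilinear_poly f \<longrightarrow> harmonic_poly n f \<longrightarrow>
       poly_degree f = d \<longrightarrow>
       real d \<le> K * sqrt (p * (1 - p) * real n) \<longrightarrow>
       measure_pmf.variance (slice_measure n k) (cube_eval f) = 1 \<longrightarrow>
       (let \<epsilon> = C * (real d / sqrt (p * (1 - p) * real n)) powr (1 / 4) in
          levy_distance (distr (measure_pmf (slice_measure n k)) borel (cube_eval f))
                        (distr (measure_pmf (product_measure n p)) borel (cube_eval f)) \<le> \<epsilon> \<and>
          (\<forall>y::real.
             measure_pmf.prob (slice_measure n k) {x. cube_eval f x \<le> y - \<epsilon>} - \<epsilon>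
               \<le> measure_pmf.prob (product_measure n p) {x. cube_eval f x \<le> y} \<and>
             measure_pmf.prob (product_measure n p) {x. cube_eval f x \<le> y}
               \<le> measure_pmf.prob (slice_measure n k) {x. cube_eval f x \<le> y + \<epsilon>} + \<epsilon>)))"
proof -
  have main: "levy_distance (distr (measure_pmf (slice_measure n k)) borel (cube_eval f))
                 (distr (measure_pmf (product_measure n p)) borel (cube_eval f)) \<le> \<epsilon> \<and>
      (\<forall>y::real.
         measure_pmf.prob (slice_measure n k) {x. cube_eval f x \<le> y - \<epsilon>} - \<epsilon>
           \<le> measure_pmf.prob (product_measure n p) {x. cube_eval f x \<le> y} \<and>
         measure_pmf.prob (product_measure n p) {x. cube_eval f x \<le> y}
           \<le> measure_pmf.prob (slice_measure n k) {x. cube_eval f x \<le> y + \<epsilon>} + \<epsilon>)"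
    if n: "n \<ge> 1" and p: "0 < p" "p < 1" "p * real n = real k"
      and ml: "multilinear_poly f" and h: "harmonic_poly n f" and deg: "poly_degree f = d"
      and var: "measure_pmf.variance (slice_measure n k) (cube_eval f) = 1"
      and \<epsilon>: "\<epsilon> = 4 * (real d / sqrt (p * (1 - p) * real n)) powr (1 / 4)"
    for n k d :: nat and p \<epsilon> :: real and f :: real_mpoly
  proof -
    define \<sigma> where "\<sigma> = sqrt (p * (1 - p) * real n)"
    \<comment> \<open>An eighth root keeps the cutoff below and the bound \<open>\<epsilon>\<close> free of fractional powers.\<close>
    define r where "r = (real d / \<sigma>) powr (1 / 8)"
    have s2: "\<sigma>\<^sup>2 = p * (1 - p) * real n" using p by (simp add: \<sigma>_def)
    have \<sigma>: "0 < \<sigma>" using p n by (simp add: \<sigma>_def)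
    have "real k \<le> 1 * real n" unfolding p(3)[symmetric] using p by (intro mult_right_mono) auto
    then have kn: "k \<le> n" by simp
    have "0 < d"
      unfolding deg[symmetric]
      by (rule poly_degree_pos_of_variance[OF ml kn]) (subst var, rule one_neq_zero)
    then have d: "1 \<le> real d" by simp
    have r: "0 < r" using d \<sigma> by (simp add: r_def)
    have r8: "r ^ 8 = real d / \<sigma>" and r2: "r\<^sup>2 = (real d / \<sigma>) powr (1 / 4)"
      using d \<sigma> by (simp_all add: r_def powr_power)
    have \<epsilon>r: "\<epsilon> = 4 * r\<^sup>2" unfolding \<epsilon> r2 \<sigma>_def ..
    have \<epsilon>0: "0 < \<epsilon>" using r by (simp add: \<epsilon>r)
    have cdf: "measure_pmf.prob (slice_measure n k) {x. cube_eval f x \<le> y - \<epsilon>} - \<epsilon>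
           \<le> measure_pmf.prob (product_measure n p) {x. cube_eval f x \<le> y} \<and>
         measure_pmf.prob (product_measure n p) {x. cube_eval f x \<le> y}
           \<le> measure_pmf.prob (slice_measure n k) {x. cube_eval f x \<le> y + \<epsilon>} + \<epsilon>" for y
    proof (cases "1 \<le> \<epsilon>")
      case True
      have "measure_pmf.prob (slice_measure n k) {x. cube_eval f x \<le> y - \<epsilon>} \<le> 1"
        "measure_pmf.prob (product_measure n p) {x. cube_eval f x \<le> y} \<le> 1" by simp_all
      moreover have "0 \<le> measure_pmf.prob (slice_measure n k) {x. cube_eval f x \<le> y + \<epsilon>}"
        "0 \<le> measure_pmf.prob (product_measure n p) {x. cube_eval f x \<le> y}" by simp_all
      ultimately show ?thesis using True by linarith
    next
      case False
      \<comment> \<open>The coupling error is of order \<open>r ^ 7 / r ^ 4\<close> and the tail error is \<open>r\<^sup>2\<close> for this cutoff,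
          so both are within \<open>\<epsilon> = 4 * r\<^sup>2\<close>.\<close>
      define T where "T = \<sigma> / r"
      have "r\<^sup>2 < (1 / 2)\<^sup>2" using False by (simp add: \<epsilon>r power2_eq_square)
      then have rh: "r < 1 / 2" by (rule power2_less_imp_less) simp
      have "r ^ 7 \<le> (1 / 2) ^ 7" using r rh by (intro power_mono) auto
      moreover have "(1 / 2 :: real) ^ 7 = 1 / 128" by (simp add: power_divide)
      ultimately have r7: "r ^ 7 \<le> 1 / 4" by linarith
      have dr: "real d = r * r ^ 7 * \<sigma>" using r8 \<sigma> power_add[of r 1 7] by (simp add: divide_eq_eq)
      have "1 \<le> (r * \<sigma>) * r ^ 7" using d dr by (simp add: mult_ac)
      also have "\<dots> \<le> (r * \<sigma>) * (1 / 4)" using r7 r \<sigma> by (intro mult_left_mono) auto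
      finally have rs: "4 \<le> r * \<sigma>" by simp
      have T: "0 < T" using r \<sigma> by (simp add: T_def)
      have "2 * \<sigma> \<le> (r * \<sigma>) * \<sigma>" using rs \<sigma> by (intro mult_right_mono) auto
      then have T2: "2 * T \<le> \<sigma>\<^sup>2" using r by (simp add: T_def field_simps power2_eq_square)
      have dT: "real d * T = r ^ 7 * \<sigma>\<^sup>2" unfolding dr T_def using r by (simp add: power2_eq_square)
      have "r ^ 7 * \<sigma>\<^sup>2 \<le> 1 / 4 * \<sigma>\<^sup>2" using r7 by (intro mult_right_mono) auto
      then have dT4: "4 * real d * T \<le> \<sigma>\<^sup>2" using dT by simp
      have "r * \<sigma> \<le> 1 * \<sigma>" using rh \<sigma> by (intro mult_right_mono) auto
      then have "r \<le> \<sigma>" using rs rh by linarith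
      then have T1: "1 \<le> T" using r by (simp add: T_def)
      let ?\<eta> = "8 * (real d * T / \<sigma>\<^sup>2) / \<epsilon>\<^sup>2 + \<sigma>\<^sup>2 / T\<^sup>2"
      have r73: "r ^ 7 = r ^ 3 * r ^ 4" using power_add[of r 3 4] by simp
      have q: "r ^ 7 / r ^ 4 = r ^ 3"
        unfolding r73 by (rule nonzero_mult_div_cancel_right) (use r in simp)
      have \<epsilon>2: "\<epsilon>\<^sup>2 = 16 * r ^ 4" by (simp add: \<epsilon>r power_mult_distrib)
      have "?\<eta> = r ^ 3 / 2 + r\<^sup>2"
        unfolding dT \<epsilon>2 unfolding T_def power_divide using r \<sigma> q by simp
      moreover have "r * r\<^sup>2 \<le> 1 * r\<^sup>2" using rh by (intro mult_right_mono) auto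
      then have "r ^ 3 \<le> r\<^sup>2" by (simp add: power3_eq_cube power2_eq_square mult.assoc)
      moreover have "0 \<le> r\<^sup>2" by simp
      ultimately have \<eta>: "?\<eta> \<le> \<epsilon>" unfolding \<epsilon>r by linarith
      show ?thesis
        by (rule conjI; insert slice_cube_close[OF p ml h deg var s2 T T2 dT4 T1 \<epsilon>0, of y] \<eta>; linarith)
    qed
    show ?thesis
      by (rule conjI[OF levy_distance_distr_le[OF \<epsilon>0 conjunct1[OF cdf] conjunct2[OF cdf]] allI[OF cdf]])
  qed
  show ?thesis
    unfolding Let_def
    by (rule exI[of _ 1], rule exI[of _ 4], (rule conjI, simp)+, (rule allI | rule impI)+,
        (rule main; (assumption | rule refl)))
qed

end
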